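(* Let $E=\mathbb R^n$ with the Euclidean metric and Lebesgue measure. Let $k\ge0$ be Borel measurable on $\mathbb R^n\times\mathbb R^n\setminus\{(x,x)\}$, $k_s(x,y)=\tfrac12(k(x,y)+k(y,x))$, $k_a(x,y)=\tfrac12(k(x,y)-k(y,x))$. Suppose $$x\mapsto\int_{y\neq x}(1\wedge|y-x|^2)k_s(x,y)\,dy\in L^2_{\mathrm{loc}}(dx),\qquad x\mapsto\int_{0<|z|\le1}|z|\,|k_s(x,x+z)-k_s(x,x-z)|\,dz\in L^2_{\mathrm{loc}}(dx),$$ $$x\mapsto\int_{\{y:\,|y-x|\ge1\}}k_s(x,y)\,dy\in L^2(dx)\cup L^\infty(dx),$$ $$\sup_{x\in\mathbb R^n}\int_{\{k_s(x,y)\neq0\}}\frac{k_a(x,y)^2}{k_s(x,y)}\,dy<\infty,\qquad \int_{0<|x-y|\le1}|x-y|\,|k_a(x,y)|\,dy<\infty\ \text{ for all }x.$$ Let $(\eta,\mathscr F^0)$ be the regular lower bounded semi-Dirichlet form on $L^2(\mathbb R^n)$ associated with $k$, and let $(L,D(L))$ be its generator. Then $C_c^2(\mathbb R^n)\subset D(L)$, and for $u\in C_c^2(\mathbb R^n)$, $$\begin{aligned}Lu(x)&=\int_{z\neq0}\big(u(x+z)-u(x)-\nabla u(x)\cdot z\,\mathbf 1_{\{|z|\le1\}}\big)k_s(x,x+z)\,dz\\&\quad+\tfrac12\nabla u(x)\cdot\int_{0<|z|\le1}z\big(k_s(x,x+z)-k_s(x,x-z)\big)\,dz+\int_{y\neq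 x}(u(y)-u(x))k_a(x,y)\,dy.\end{aligned}$$
   Context: $C_c^{\mathrm{lip}}(\mathbb R^n)$ denotes the compactly supported Lipschitz functions. Let $\mathscr E(u,v)=\iint_{y\neq x}(u(x)-u(y))(v(x)-v(y))k_s(x,y)\,dx\,dy$, $\mathscr F^r=\{u\in L^2(\mathbb R^n):\mathscr E(u,u)<\infty\}$, and let $\mathscr F^0$ be the closure of $C_c^{\mathrm{lip}}(\mathbb R^n)$ in $\mathscr F^r$ for the norm $(\mathscr E(u,u)+\|u\|_{L^2}^2)^{1/2}$. The form $\eta$ is defined for $u,v\in C_c^{\mathrm{lip}}(\mathbb R^n)$ by $\eta(u,v)=\frac12\mathscr E(u,v)+\iint_{y\neq x}(u(x)-u(y))v(y)k_a(x,y)\,dx\,dy$ (equivalently $\eta(u,v)=\lim_{n\to\infty}-\int\big(\int_{|x-y|>1/n}(u(y)-u(x))k(x,y)\,dy\big)v(x)\,dx$) and extended by continuity to $\mathscr F^0\times\mathscr F^0$; under the hypotheses it is a regular lower bounded semi-Dirichlet form. Its generator is the operator $L$ with domain $D(L)=\{u\in\mathscr F^0: v\mapsto\eta(u,v)\text{ is continuous on }\mathscr F^0\text{ w.r.t. }\|\cdot\|_{L^2}\}$ mapping $D(L)$ into $L^2(\mathbb R^n)$ with $\eta(u,v)=-\langle Lu,v\rangle_{L^2}$ for $u\in D(L)$, $v\in\mathscr F^0$. *)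

theory Defs
  imports "HOL-Analysis.Analysis"
begin

definition ks :: "('a \<Rightarrow> 'a \<Rightarrow> real) \<Rightarrow> 'a \<Rightarrow> 'a \<Rightarrow> real" where
  "ks k x y = (k x y + k y x) / 2"

definition ka :: "('a \<Rightarrow> 'a \<Rightarrow> real) \<Rightarrow> 'a \<Rightarrow> 'a \<Rightarrow> real" where
  "ka k x y = (k x y - k y x) / 2"

definition Lipc :: "('a::euclidean_space \<Rightarrow> real) set" where
  "Lipc = {u. (\<exists>C. C-lipschitz_on UNIV u) \<and> compact (closure {x. u x \<noteq> 0})}"

definition C2 :: "('a::euclidean_space \<Rightarrow> real) \<Rightarrow> bool" where
  "C2 u \<longleftrightarrow> (\<exists>(Du :: 'a \<Rightarrow> 'a \<Rightarrow>\<^sub>L real) (D2u :: 'a \<Rightarrow> 'a \<Rightarrow>\<^sub>L ('a \<Rightarrow>\<^sub>L real)).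
      (\<forall>x. (u has_derivative blinfun_apply (Du x)) (at x)) \<and>
      (\<forall>x. (Du has_derivative blinfun_apply (D2u x)) (at x)) \<and>
      continuous_on UNIV D2u)"

definition C2c :: "('a::euclidean_space \<Rightarrow> real) set" where
  "C2c = {u. C2 u \<and> compact (closure {x. u x \<noteq> 0})}"

definition L2 :: "('a::euclidean_space \<Rightarrow> real) set" where
  "L2 = {f. f \<in> borel_measurable lborel \<and> integrable lborel (\<lambda>x. (f x)^2)}"

definition L2norm :: "('a::euclidean_space \<Rightarrow> real) \<Rightarrow> real" where
  "L2norm f = sqrt (\<integral>x. (f x)^2 \<partial>lborel)"

definition Eform :: "('a::euclidean_space \<Rightarrow> 'a \<Rightarrow> real) \<Rightarrow> ('a \<Rightarrow> real) \<Rightarrow> ('a \<Rightarrow> real) \<Rightarrow> real" where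
  "Eform k u v = (LINT p:{(x,y). y \<noteq> x}|(lborel \<Otimes>\<^sub>M lborel).
      (u (fst p) - u (snd p)) * (v (fst p) - v (snd p)) * ks k (fst p) (snd p))"

definition Energy :: "('a::euclidean_space \<Rightarrow> 'a \<Rightarrow> real) \<Rightarrow> ('a \<Rightarrow> real) \<Rightarrow> ennreal" where
  "Energy k u = (\<integral>\<^sup>+ p\<in>{(x,y). y \<noteq> x}.
      ennreal ((u (fst p) - u (snd p))^2 * ks k (fst p) (snd p)) \<partial>(lborel \<Otimes>\<^sub>M lborel))"

definition Fr :: "('a::euclidean_space \<Rightarrow> 'a \<Rightarrow> real) \<Rightarrow> ('a \<Rightarrow> real) set" where
  "Fr k = {u. u \<in> L2 \<and> Energy k u < \<infinity>}"

definition E1sq :: "('a::euclidean_space \<Rightarrow> 'a \<Rightarrow> real) \<Rightarrow> ('a \<Rightarrow> real) \<Rightarrow> ennreal" where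
  "E1sq k w = Energy k w + (\<integral>\<^sup>+ x. ennreal ((w x)^2) \<partial>lborel)"

definition F0 :: "('a::euclidean_space \<Rightarrow> 'a \<Rightarrow> real) \<Rightarrow> ('a \<Rightarrow> real) set" where
  "F0 k = {u. u \<in> Fr k \<and> (\<exists>\<phi>. (\<forall>n. \<phi> n \<in> Lipc) \<and>
              (\<lambda>n. E1sq k (\<lambda>x. \<phi> n x - u x)) \<longlonglongrightarrow> 0)}"

definition eta0 :: "('a::euclidean_space \<Rightarrow> 'a \<Rightarrow> real) \<Rightarrow> ('a \<Rightarrow> real) \<Rightarrow> ('a \<Rightarrow> real) \<Rightarrow> real" where
  "eta0 k u v = Eform k u v / 2 +
     (LINT p:{(x,y). y \<noteq> x}|(lborel \<Otimes>\<^sub>M lborel).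
        (u (fst p) - u (snd p)) * v (snd p) * ka k (fst p) (snd p))"

text \<open>The extension of eta by continuity to F^0 x F^0.\<close>
definition eta :: "('a::euclidean_space \<Rightarrow> 'a \<Rightarrow> real) \<Rightarrow> ('a \<Rightarrow> real) \<Rightarrow> ('a \<Rightarrow> real) \<Rightarrow> real" where
  "eta k u v = (THE c. \<forall>\<phi> \<psi>. (\<forall>n. \<phi> n \<in> Lipc \<and> \<psi> n \<in> Lipc) \<and>
       (\<lambda>n. E1sq k (\<lambda>x. \<phi> n x - u x)) \<longlonglongrightarrow> 0 \<and>
       (\<lambda>n. E1sq k (\<lambda>x. \<psi> n x - v x)) \<longlonglongrightarrow> 0 \<longrightarrow>
       (\<lambda>n. eta0 k (\<phi> n) (\<psi> n)) \<longlonglongrightarrow> c)"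

definition genD :: "('a::euclidean_space \<Rightarrow> 'a \<Rightarrow> real) \<Rightarrow> ('a \<Rightarrow> real) set" where
  "genD k = {u. u \<in> F0 k \<and> (\<forall>v\<in>F0 k. \<forall>\<epsilon>>0. \<exists>\<delta>>0. \<forall>w\<in>F0 k.
       L2norm (\<lambda>x. w x - v x) < \<delta> \<longrightarrow> \<bar>eta k u w - eta k u v\<bar> < \<epsilon>)}"

text \<open>f is (a representative of) the generator applied to u: Lu = f.\<close>
definition is_gen :: "('a::euclidean_space \<Rightarrow> 'a \<Rightarrow> real) \<Rightarrow> ('a \<Rightarrow> real) \<Rightarrow> ('a \<Rightarrow> real) \<Rightarrow> bool" where
  "is_gen k u f \<longleftrightarrow> u \<in> genD k \<and> f \<in> L2 \<and>
     (\<forall>v\<in>F0 k. eta k u v = - (\<integral>x. f x * v x \<partial>lborel))"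

end

theory Submission
  imports Defs
begin

text \<open>Write \<open>eta0 k u v\<close> as \<open>\<langle>grad u, grad v\<rangle> / 2 + \<langle>grad u, twist v\<rangle>\<close> in \<open>L\<^sup>2\<close> of the product space. The sector
  condition bounds \<open>twist v\<close> by the \<open>L\<^sup>2\<close> norm of \<open>v\<close>, so \<open>eta0\<close> is defined and continuous for the energy norm
  on all of \<open>Fr\<close> and its extension \<open>eta\<close> agrees with it on \<open>F0\<close>.

  For \<open>u\<close> in \<open>C2c\<close>, Taylor's formula and Cauchy--Schwarz dominate the integrand of \<open>L u (x)\<close> by a function that is
  locally square integrable in \<open>x\<close>. Away from the support of \<open>u\<close> only large jumps contribute, and these are
  controlled by the tail condition: if the tail mass is merely bounded, its restriction to jumps into the
  support is also integrable, by symmetry of \<open>ks\<close>, hence square integrable.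

  The identity \<open>eta0 u v = -\<integral> L u v\<close> for Lipschitz \<open>v\<close> follows by removing the jumps of size at most \<open>e\<close>, where
  everything is absolutely integrable and cancels under \<open>(x, y) \<mapsto> (y, x)\<close> and \<open>(x, y) \<mapsto> (x, 2x - y)\<close>, and then
  letting \<open>e\<close> tend to \<open>0\<close>. Density of Lipschitz functions gives it on \<open>F0\<close>.\<close>

section \<open>Integration on the square of a Euclidean space\<close>

abbreviation (input) lborel2 :: "('a::euclidean_space \<times> 'a) measure" where
  "lborel2 \<equiv> lborel \<Otimes>\<^sub>M lborel"

section \<open>Cauchy--Schwarz for square integrable functions\<close>

lemma norm_integral_le_nn_integral:
  fixes f :: "'a \<Rightarrow> 'b::{banach, second_countable_topology}"
  shows "ennreal (norm (integral\<^sup>L M f)) \<le> (\<integral>\<^sup>+x. ennreal (norm (f x)) \<partial>M)"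
\<comment> \<open>A non-integrable function has integral 0 by convention, so the bound is trivial
  for it.\<close>
proof (cases "integrable M f")
  case True
  then show ?thesis by (rule integral_norm_bound_ennreal)
qed (simp add: not_integrable_integral_eq)

lemma ennreal_power2_le_imp_le:
  assumes "x\<^sup>2 \<le> (ennreal r)\<^sup>2" "0 \<le> r"
  shows "x \<le> ennreal r"
proof (cases x)
  case (real t)
  then have "t\<^sup>2 \<le> r\<^sup>2" using assms by (simp add: ennreal_power ennreal_le_iff)
  then show ?thesis using real assms power2_le_imp_le by (auto intro: ennreal_leI)
next
  case top
  then show ?thesis using assms by (simp add: ennreal_power top_unique power2_eq_square ennreal_mult_eq_top_iff)
qed

text \<open>One estimate of the nonnegative integral of \<open>\<bar>f x * g x\<bar>\<close> serves
  twice: it gives integrability of the product and then bounds its integral.\<close>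

lemma Cauchy_Schwarz_integral:
  fixes f g :: "'a \<Rightarrow> real"
  assumes [measurable]: "f \<in> borel_measurable M" "g \<in> borel_measurable M"
    and f: "integrable M (\<lambda>x. (f x)\<^sup>2)" and g: "integrable M (\<lambda>x. (g x)\<^sup>2)"
  shows "integrable M (\<lambda>x. f x * g x)"
    and "\<bar>\<integral>x. f x * g x \<partial>M\<bar> \<le> sqrt (\<integral>x. (f x)\<^sup>2 \<partial>M) * sqrt (\<integral>x. (g x)\<^sup>2 \<partial>M)"
proof -
  let ?F = "\<integral>x. (f x)\<^sup>2 \<partial>M" and ?G = "\<integral>x. (g x)\<^sup>2 \<partial>M"
  have "(\<integral>\<^sup>+x. ennreal (norm (f x * g x)) \<partial>M)\<^sup>2
      = (\<integral>\<^sup>+x. ennreal \<bar>f x\<bar> * ennreal \<bar>g x\<bar> \<partial>M)\<^sup>2"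
    by (simp add: abs_mult ennreal_mult')
  also have "\<dots> \<le> (\<integral>\<^sup>+x. ennreal \<bar>f x\<bar> ^ 2 \<partial>M) * (\<integral>\<^sup>+x. ennreal \<bar>g x\<bar> ^ 2 \<partial>M)"
    by (rule Cauchy_Schwarz_nn_integral) auto
  also have "\<dots> = ennreal ?F * ennreal ?G"
    using nn_integral_eq_integral[OF f] nn_integral_eq_integral[OF g] by (simp add: ennreal_power)
  also have "\<dots> = ennreal ((sqrt ?F * sqrt ?G)\<^sup>2)"
    by (simp add: power_mult_distrib ennreal_mult')
  finally have "(\<integral>\<^sup>+x. ennreal (norm (f x * g x)) \<partial>M)\<^sup>2 \<le> (ennreal (sqrt ?F * sqrt ?G))\<^sup>2"
    by (subst ennreal_power) auto
  then have *: "(\<integral>\<^sup>+x. ennreal (norm (f x * g x)) \<partial>M) \<le> ennreal (sqrt ?F * sqrt ?G)"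
    by (rule ennreal_power2_le_imp_le) auto
  show "integrable M (\<lambda>x. f x * g x)"
    by (rule integrableI_bounded) (use * in \<open>auto intro: le_less_trans\<close>)
  have "ennreal \<bar>\<integral>x. f x * g x \<partial>M\<bar> \<le> ennreal (sqrt ?F * sqrt ?G)"
    using order_trans[OF norm_integral_le_nn_integral[of M "\<lambda>x. f x * g x"] *] by simp
  then show "\<bar>\<integral>x. f x * g x \<partial>M\<bar> \<le> sqrt ?F * sqrt ?G"
    by (subst (asm) ennreal_le_iff) auto
qed

section \<open>Invariance of Lebesgue measure under translation, reflection and exchange of
  variables\<close>

lemma distr_lborel_reflect:
  fixes t :: "'a::euclidean_space"
  shows "distr lborel borel (\<lambda>y. t - y) = lborel"
  \<comment> \<open>Reflection is the affine map with factor \<open>-1\<close>, whose Jacobian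
    factor is 1.\<close>
  using lborel_affine[of "-1" t] by (simp add: density_1)

lemma nn_integral_lborel_translate:
  fixes x :: "'a::euclidean_space"
  assumes [measurable]: "f \<in> borel_measurable borel"
  shows "(\<integral>\<^sup>+z. f (x + z) \<partial>lborel) = (\<integral>\<^sup>+y. f y \<partial>lborel)"
  using nn_integral_distr[of "(+) x" lborel borel f] by (simp add: lborel_distr_plus)

lemma integral_lborel_translate:
  fixes x :: "'a::euclidean_space" and f :: "'a \<Rightarrow> 'b::{banach, second_countable_topology}"
  assumes [measurable]: "f \<in> borel_measurable borel"
  shows "(\<integral>z. f (x + z) \<partial>lborel) = (\<integral>y. f y \<partial>lborel)"
  using integral_distr[of "(+) x" lborel borel f] by (simp add: lborel_distr_plus)

lemma nn_integral_lborel_reflect: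
  fixes x :: "'a::euclidean_space"
  assumes [measurable]: "f \<in> borel_measurable borel"
  shows "(\<integral>\<^sup>+y. f (x - y) \<partial>lborel) = (\<integral>\<^sup>+y. f y \<partial>lborel)"
  using nn_integral_distr[of "\<lambda>y. x - y" lborel borel f] by (simp add: distr_lborel_reflect)

lemma distr_lborel2_swap:
  "distr lborel2 lborel2 (\<lambda>p. (snd p, fst p)) = (lborel2 :: ('a::euclidean_space \<times> 'a) measure)"
  using lborel_pair.distr_pair_swap[where 'a='a and 'b='a] by (simp add: case_prod_unfold)

text \<open>On the fibre over a fixed \<open>x\<close> this is the point reflection in
  \<open>x\<close>, which changes the sign of the increment \<open>y - x\<close>. Tonelli reduces
  the claim to the reflection of a single variable.\<close>

lemma distr_lborel2_reflect:
  "distr lborel2 lborel2 (\<lambda>p. (fst p, 2 *\<^sub>R fst p - snd p))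
    = (lborel2 :: ('a::euclidean_space \<times> 'a) measure)"
proof (rule measure_eqI)
  let ?r = "\<lambda>p::'a \<times> 'a. (fst p, 2 *\<^sub>R fst p - snd p)"
  have [measurable]: "?r \<in> lborel2 \<rightarrow>\<^sub>M lborel2" by simp
  fix A :: "('a \<times> 'a) set"
  assume "A \<in> sets (distr lborel2 lborel2 ?r)"
  then have A[measurable]: "A \<in> sets lborel2" by simp
  have "emeasure (distr lborel2 lborel2 ?r) A = (\<integral>\<^sup>+p. indicator A (?r p) \<partial>lborel2)"
    by (subst nn_integral_distr[symmetric, where M' = lborel2]) (use A in auto)
  also have "\<dots> = (\<integral>\<^sup>+x. \<integral>\<^sup>+y. indicator A (?r (x, y)) \<partial>lborel \<partial>lborel)"
    by (subst lborel.nn_integral_fst) auto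
  also have "\<dots> = (\<integral>\<^sup>+x. \<integral>\<^sup>+y. indicator A (x, y) \<partial>lborel \<partial>lborel)"
  proof (rule nn_integral_cong)
    fix x :: 'a
    show "(\<integral>\<^sup>+y. indicator A (?r (x, y)) \<partial>lborel) = (\<integral>\<^sup>+y. indicator A (x, y) \<partial>lborel)"
      using nn_integral_lborel_reflect[of "\<lambda>y. indicator A (x, y)" "2 *\<^sub>R x"] by simp
  qed
  also have "\<dots> = emeasure lborel2 A"
    using A by (subst lborel.nn_integral_fst) auto
  finally show "emeasure (distr lborel2 lborel2 ?r) A = emeasure lborel2 A" .
qed simp

lemma
  fixes f :: "'a::euclidean_space \<times> 'a \<Rightarrow> real"
  assumes f: "integrable lborel2 f"
  shows integrable_lborel2_swap: "integrable lborel2 (\<lambda>p. f (snd p, fst p))"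
    and integral_lborel2_swap: "(\<integral>p. f (snd p, fst p) \<partial>lborel2) = (\<integral>p. f p \<partial>lborel2)"
    and integrable_lborel2_reflect: "integrable lborel2 (\<lambda>p. f (fst p, 2 *\<^sub>R fst p - snd p))"
    and integral_lborel2_reflect: "(\<integral>p. f (fst p, 2 *\<^sub>R fst p - snd p) \<partial>lborel2) = (\<integral>p. f p \<partial>lborel2)"
proof -
  have [measurable]: "f \<in> borel_measurable lborel2" using f by simp
  have s: "(\<lambda>p. (snd p, fst p)) \<in> lborel2 \<rightarrow>\<^sub>M (lborel2 :: ('a \<times> 'a) measure)"
    and r: "(\<lambda>p. (fst p, 2 *\<^sub>R fst p - snd p)) \<in> lborel2 \<rightarrow>\<^sub>M (lborel2 :: ('a \<times> 'a) measure)" by simp_all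
  show "integrable lborel2 (\<lambda>p. f (snd p, fst p))"
    using integrable_distr[OF s, of f] f by (simp add: distr_lborel2_swap)
  show "(\<integral>p. f (snd p, fst p) \<partial>lborel2) = (\<integral>p. f p \<partial>lborel2)"
    using integral_distr[OF s, of f] by (simp add: distr_lborel2_swap)
  show "integrable lborel2 (\<lambda>p. f (fst p, 2 *\<^sub>R fst p - snd p))"
    using integrable_distr[OF r, of f] f by (simp add: distr_lborel2_reflect)
  show "(\<integral>p. f (fst p, 2 *\<^sub>R fst p - snd p) \<partial>lborel2) = (\<integral>p. f p \<partial>lborel2)"
    using integral_distr[OF r, of f] by (simp add: distr_lborel2_reflect)
qed

section \<open>Local square integrability\<close>

lemma ennreal_le_1_plus_square: "(x::ennreal) \<le> 1 + x\<^sup>2"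
proof (cases x)
  case (real t)
  have "2 * t \<le> t\<^sup>2 + 1" "0 \<le> t\<^sup>2"
    using zero_le_power2[of "t - 1"] by (simp_all add: power2_diff)
  then have "t \<le> 1 + t\<^sup>2" by linarith
  then show ?thesis using real
    by (simp add: ennreal_power flip: ennreal_1 ennreal_plus)
qed (simp add: power2_eq_square)

lemma ennreal_square_add_le: "((x::ennreal) + y)\<^sup>2 \<le> 2 * (x\<^sup>2 + y\<^sup>2)"
proof (cases "x = top \<or> y = top")
  case True
  then show ?thesis by (auto simp: power2_eq_square ennreal_mult_top)
next
  case False
  then obtain s t where st: "x = ennreal s" "0 \<le> s" "y = ennreal t" "0 \<le> t"
    by (metis ennreal_cases)
  have "(s + t)\<^sup>2 \<le> 2 * (s\<^sup>2 + t\<^sup>2)"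
    using zero_le_power2[of "s - t"] by (simp add: power2_diff power2_sum)
  then have "ennreal ((s + t)\<^sup>2) \<le> ennreal (2 * (s\<^sup>2 + t\<^sup>2))"
    by (rule ennreal_leI)
  moreover have "(x + y)\<^sup>2 = ennreal ((s + t)\<^sup>2)"
    using st by (simp add: ennreal_power flip: ennreal_plus)
  moreover have "2 * (x\<^sup>2 + y\<^sup>2) = ennreal (2 * (s\<^sup>2 + t\<^sup>2))"
    using st by (simp add: ennreal_power ennreal_mult)
  ultimately show ?thesis by simp
qed

text \<open>Pointwise \<open>f x \<le> 1 + (f x)\<^sup>2\<close>, and a compact set has finite
  measure.\<close>

lemma nn_integral_compact_finite:
  fixes f :: "'a::euclidean_space \<Rightarrow> ennreal"
  assumes [measurable]: "f \<in> borel_measurable borel" and K: "compact K"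
    and fin: "(\<integral>\<^sup>+x\<in>K. (f x)\<^sup>2 \<partial>lborel) < \<infinity>"
  shows "(\<integral>\<^sup>+x\<in>K. f x \<partial>lborel) < \<infinity>"
proof -
  have [measurable]: "K \<in> sets borel" using K by (simp add: borel_compact)
  have "(\<integral>\<^sup>+x\<in>K. f x \<partial>lborel) \<le> (\<integral>\<^sup>+x. indicator K x + (f x)\<^sup>2 * indicator K x \<partial>lborel)"
    by (intro nn_integral_mono) (auto simp: ennreal_le_1_plus_square split: split_indicator)
  also have "\<dots> = emeasure lborel K + (\<integral>\<^sup>+x\<in>K. (f x)\<^sup>2 \<partial>lborel)"
    by (subst nn_integral_add) auto
  also have "\<dots> < \<infinity>"
    using fin emeasure_compact_finite[OF K] by simp
  finally show ?thesis .
qed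

lemma min_1_power2:
  assumes "0 \<le> (t::real)"
  shows "(min 1 t)\<^sup>2 = min 1 (t\<^sup>2)"
proof (cases "t \<le> 1")
  case True
  then show ?thesis using assms power_le_one[of t 2] by (simp add: min_def)
next
  case False
  then show ?thesis using one_le_power[of t 2] by (simp add: min_def)
qed

text \<open>Countably many balls cover the space, and the function is finite almost everywhere on
  each of them.\<close>

lemma AE_finite_of_compact:
  fixes f :: "'a::euclidean_space \<Rightarrow> ennreal"
  assumes [measurable]: "f \<in> borel_measurable borel"
    and fin: "\<And>K. compact K \<Longrightarrow> (\<integral>\<^sup>+x\<in>K. f x \<partial>lborel) < \<infinity>"
  shows "AE x in lborel. f x < \<infinity>"
proof -
  have "AE x in lborel. \<forall>n. f x * indicator (cball 0 (real n)) x \<noteq> \<infinity>"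
    unfolding AE_all_countable
  proof
    fix n
    have [measurable]: "cball 0 (real n) \<in> sets (borel :: 'a measure)" by simp
    show "AE x in lborel. f x * indicator (cball 0 (real n)) x \<noteq> \<infinity>"
      using fin[of "cball 0 (real n)"] by (intro nn_integral_PInf_AE) auto
  qed
  then show ?thesis
  proof (rule AE_mp, intro AE_I2 impI)
    fix x :: 'a
    assume *: "\<forall>n. f x * indicator (cball 0 (real n)) x \<noteq> \<infinity>"
    obtain n where "norm x \<le> real n" using real_arch_simple by blast
    then show "f x < \<infinity>" using *[rule_format, of n] by (simp add: less_top)
  qed
qed

lemma bounded_of_compact_support:
  fixes h :: "'a::euclidean_space \<Rightarrow> 'b::real_normed_vector"
  assumes cont: "continuous_on UNIV h" and K: "compact K" and zero: "\<And>x. x \<notin> K \<Longrightarrow> h x = 0"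
  obtains B where "0 \<le> B" "\<And>x. norm (h x) \<le> B"
proof -
  have "bounded (h ` K)"
    using K continuous_on_subset[OF cont] by (intro compact_imp_bounded compact_continuous_image) auto
  then obtain M where M: "\<forall>t\<in>h ` K. norm t \<le> M"
    unfolding bounded_iff by blast
  \<comment> \<open>The maximum with 0 covers an empty \<open>K\<close>, for which \<open>M\<close>
    is arbitrary and may be negative.\<close>
  have "norm (h x) \<le> max M 0" for x
    using M[rule_format, OF imageI, of x] zero[of x] by (cases "x \<in> K") auto
  then show thesis by (intro that[of "max M 0"]) auto
qed

text \<open>Near \<open>x\<close> the function agrees with the constant 0, and derivatives are
  unique. Applied twice, it makes the first and second derivative vanish off the support.\<close>

lemma has_derivative_zero_on_open:
  assumes "(f has_derivative F) (at x)" "open S" "x \<in> S" "\<And>y. y \<in> S \<Longrightarrow> f y = 0"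
  shows "F = (\<lambda>_. 0)"
proof -
  have "((\<lambda>_. 0) has_derivative F) (at x)"
    using assms by (intro has_derivative_transform_within_open[OF assms(1-3)]) auto
  then show ?thesis by (rule has_derivative_unique) (rule has_derivative_const)
qed

section \<open>Compactly supported functions\<close>

text \<open>One constant and the weight \<open>min 1 (norm (y - x))\<close> cover short and long
  increments alike; the square of this weight is the one integrated in
  \<open>near_mass\<close>.\<close>

lemma LipcE:
  assumes "u \<in> Lipc"
  obtains C R where "0 \<le> C" "continuous_on UNIV u" "\<And>x. R < norm x \<Longrightarrow> u x = 0"
    "\<And>x. \<bar>u x\<bar> \<le> C" "\<And>x y. \<bar>u x - u y\<bar> \<le> C * min 1 (norm (y - x))"
proof -
  from assms obtain L where L: "L-lipschitz_on UNIV u" and K: "compact (closure {x. u x \<noteq> 0})"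
    by (auto simp: Lipc_def)
  have cont: "continuous_on UNIV u" using L by (rule lipschitz_on_continuous_on)
  have zero: "u x = 0" if "x \<notin> closure {x. u x \<noteq> 0}" for x
    using that closure_subset[of "{x. u x \<noteq> 0}"] by blast
  obtain R where R: "\<And>x. x \<in> closure {x. u x \<noteq> 0} \<Longrightarrow> norm x \<le> R"
    using compact_imp_bounded[OF K] unfolding bounded_iff by blast
  obtain M where M: "0 \<le> M" "\<And>x. norm (u x) \<le> M"
    by (rule bounded_of_compact_support[OF cont K zero]) auto
  \<comment> \<open>\<open>L\<close> serves distances up to 1; beyond that an increment is at most
    twice the supremum of \<open>\<bar>u\<bar>\<close>.\<close>
  define C where "C = max L (2 * M)"
  show thesis
  proof
    show "0 \<le> C" using M(1) by (simp add: C_def)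
    show "continuous_on UNIV u" by fact
    show "u x = 0" if "R < norm x" for x
    proof (rule zero)
      show "x \<notin> closure {x. u x \<noteq> 0}" using R that by force
    qed
    show "\<bar>u x\<bar> \<le> C" for x using M(1) M(2)[of x] by (simp add: C_def)
    show "\<bar>u x - u y\<bar> \<le> C * min 1 (norm (y - x))" for x y
    proof (cases "norm (y - x) \<le> 1")
      case True
      have "\<bar>u x - u y\<bar> \<le> L * norm (y - x)"
        using lipschitz_onD[OF L, of x y] by (simp add: dist_norm norm_minus_commute)
      also have "\<dots> \<le> C * norm (y - x)" by (intro mult_right_mono) (auto simp: C_def)
      finally show ?thesis using True by (simp add: min_def)
    next
      case False
      have "\<bar>u x - u y\<bar> \<le> 2 * M" using M(2)[of x] M(2)[of y] by simp
      then show ?thesis using False by (simp add: C_def)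
    qed
  qed
qed

text \<open>Turns the qualitative hypothesis into uniform bounds. Continuity of the second
  derivative and compactness of the support make it bounded, and this bound yields the quadratic
  remainder.\<close>

lemma C2cE:
  fixes u :: "'a::euclidean_space \<Rightarrow> real"
  assumes "u \<in> C2c"
  obtains Du C R where "\<And>x. (u has_derivative blinfun_apply (Du x)) (at x)" "continuous_on UNIV Du"
    "\<And>x. R < norm x \<Longrightarrow> u x = 0" "\<And>x. R < norm x \<Longrightarrow> Du x = 0" "0 \<le> C"
    "\<And>x. \<bar>u x\<bar> \<le> C" "\<And>x. norm (Du x) \<le> C"
    "\<And>x y. \<bar>u y - u x\<bar> \<le> C * min 1 (norm (y - x))"
    "\<And>x y. \<bar>u y - u x - Du x (y - x)\<bar> \<le> C * (norm (y - x))\<^sup>2"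
proof -
  define K where "K = closure {x. u x \<noteq> 0}"
  from assms obtain Du D2u where Du: "\<And>x. (u has_derivative blinfun_apply (Du x)) (at x)"
    and D2u: "\<And>x. (Du has_derivative blinfun_apply (D2u x)) (at x)"
    and cont: "continuous_on UNIV D2u" and K: "compact K"
    unfolding C2c_def C2_def K_def by blast
  have op: "open (- K)" by (simp add: K_def open_Compl)
  have u0: "u x = 0" if "x \<notin> K" for x
    using that closure_subset[of "{x. u x \<noteq> 0}"] unfolding K_def by blast
  have Du0: "Du x = 0" if "x \<notin> K" for x
    using has_derivative_zero_on_open[OF Du[of x] op] that u0
    by (intro blinfun_eqI) auto
  have D2u0: "D2u x = 0" if "x \<notin> K" for x
    using has_derivative_zero_on_open[OF D2u[of x] op] that Du0
    by (intro blinfun_eqI) auto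
  have contDu: "continuous_on UNIV Du"
    using D2u by (intro has_derivative_continuous_on) auto
  have contu: "continuous_on UNIV u"
    using Du by (intro has_derivative_continuous_on) auto
  obtain B0 where B0: "0 \<le> B0" "\<And>x. norm (u x) \<le> B0"
    by (rule bounded_of_compact_support[OF contu K u0]) auto
  obtain B1 where B1: "0 \<le> B1" "\<And>x. norm (Du x) \<le> B1"
    by (rule bounded_of_compact_support[OF contDu K Du0]) auto
  obtain B2 where B2: "0 \<le> B2" "\<And>x. norm (D2u x) \<le> B2"
    by (rule bounded_of_compact_support[OF cont K D2u0]) auto
  obtain R where R: "\<And>x. x \<in> K \<Longrightarrow> norm x \<le> R"
    using compact_imp_bounded[OF K] unfolding bounded_iff by blast
  have R': "x \<notin> K" if "R < norm x" for x using R[of x] that by linarith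
  have lip_u: "\<bar>u y - u x\<bar> \<le> B1 * norm (y - x)" for x y
    using differentiable_bound[of UNIV u "\<lambda>x. blinfun_apply (Du x)" B1 y x] Du B1(2)
    by (simp add: norm_blinfun.rep_eq)
  have lip_Du: "norm (Du y - Du x) \<le> B2 * norm (y - x)" for x y
    using differentiable_bound[of UNIV Du "\<lambda>x. blinfun_apply (D2u x)" B2 y x] D2u B2(2)
    by (simp add: norm_blinfun.rep_eq)
  \<comment> \<open>This is the mean value inequality for \<open>w \<mapsto> u w - Du x w\<close> on
    the convex ball around \<open>x\<close> through \<open>y\<close>. Its derivative
    \<open>Du w - Du x\<close> is at most \<open>B2 * norm (y - x)\<close> there.\<close>
  have taylor: "\<bar>u y - u x - Du x (y - x)\<bar> \<le> B2 * (norm (y - x))\<^sup>2" for x y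
  proof -
    let ?S = "cball x (norm (y - x))"
    have "norm ((u y - Du x y) - (u x - Du x x)) \<le> B2 * norm (y - x) * norm (y - x)"
    proof (rule differentiable_bound[of ?S _ "\<lambda>w. blinfun_apply (Du w - Du x)"])
      fix w assume w: "w \<in> ?S"
      show "((\<lambda>w. u w - Du x w) has_derivative blinfun_apply (Du w - Du x)) (at w within ?S)"
        by (auto intro!: derivative_eq_intros has_derivative_at_withinI[OF Du] simp: blinfun.diff_left)
      have "norm (Du w - Du x) \<le> B2 * norm (w - x)" by (rule lip_Du)
      also have "\<dots> \<le> B2 * norm (y - x)"
        using w B2(1) by (intro mult_left_mono) (auto simp: dist_norm norm_minus_commute)
      finally show "onorm (blinfun_apply (Du w - Du x)) \<le> B2 * norm (y - x)"
        by (simp add: norm_blinfun.rep_eq)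
    qed (auto simp: dist_norm norm_minus_commute)
    then show ?thesis by (simp add: blinfun.diff_right power2_eq_square algebra_simps)
  qed
  \<comment> \<open>\<open>2 * B0\<close> bounds increments over distances above 1,
    \<open>B1\<close> the shorter ones, and \<open>B2\<close> the Taylor remainder.\<close>
  define C where "C = 2 * B0 + B1 + B2"
  show thesis
  proof (rule that[of Du R C])
    show "0 \<le> C" using B0(1) B1(1) B2(1) by (simp add: C_def)
    show "\<bar>u x\<bar> \<le> C" for x using B0(1) B0(2)[of x] B1(1) B2(1) by (simp add: C_def)
    show "norm (Du x) \<le> C" for x using B0(1) B1(2)[of x] B2(1) by (simp add: C_def)
    show "\<bar>u y - u x\<bar> \<le> C * min 1 (norm (y - x))" for x y
    proof (cases "norm (y - x) \<le> 1")
      case True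
      have "\<bar>u y - u x\<bar> \<le> B1 * norm (y - x)" by (rule lip_u)
      also have "\<dots> \<le> C * norm (y - x)"
        using B0(1) B2(1) by (intro mult_right_mono) (auto simp: C_def)
      finally show ?thesis using True by (simp add: min_def)
    next
      case False
      have "\<bar>u y - u x\<bar> \<le> 2 * B0" using B0(2)[of x] B0(2)[of y] by simp
      then show ?thesis using False B1(1) B2(1) by (simp add: C_def)
    qed
    show "\<bar>u y - u x - Du x (y - x)\<bar> \<le> C * (norm (y - x))\<^sup>2" for x y
    proof -
      have "B2 * (norm (y - x))\<^sup>2 \<le> C * (norm (y - x))\<^sup>2"
        using B0(1) B1(1) by (intro mult_right_mono) (auto simp: C_def)
      then show ?thesis using taylor[of y x] by linarith
    qed
  qed (use Du contDu u0 Du0 R' in auto)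
qed

lemma C2c_subset_Lipc: "C2c \<subseteq> Lipc"
proof
  fix u :: "'a \<Rightarrow> real"
  assume u: "u \<in> C2c"
  obtain C where C: "0 \<le> C" and lip: "\<And>x y. \<bar>u y - u x\<bar> \<le> C * min 1 (norm (y - x))"
    using u by (rule C2cE) blast
  have "C-lipschitz_on UNIV u"
  proof (rule lipschitz_onI)
    fix x y
    have "\<bar>u x - u y\<bar> \<le> C * min 1 (norm (x - y))" by (rule lip)
    also have "\<dots> \<le> C * norm (x - y)" using C by (intro mult_left_mono) auto
    finally show "dist (u x) (u y) \<le> C * dist x y" by (simp add: dist_norm)
  qed (rule C)
  then show "u \<in> Lipc" using u by (auto simp: Lipc_def C2c_def)
qed

section \<open>The form on the reflected domain\<close>

text \<open>The weight vanishes at \<open>y = x\<close>, so integrating over all \<open>y\<close> is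
  the same as removing the diagonal.\<close>

definition near_mass :: "('a::euclidean_space \<Rightarrow> 'a \<Rightarrow> real) \<Rightarrow> 'a \<Rightarrow> ennreal" where
  "near_mass k x = (\<integral>\<^sup>+ y. ennreal (min 1 ((norm (y - x))\<^sup>2) * ks k x y) \<partial>lborel)"

text \<open>Integrals in the increment \<open>z\<close> are written in the variable \<open>y = x + z\<close>, so that \<open>x - z\<close>
  becomes \<open>2x - y\<close>.\<close>
definition asymmetry :: "('a::euclidean_space \<Rightarrow> 'a \<Rightarrow> real) \<Rightarrow> 'a \<Rightarrow> ennreal" where
  "asymmetry k x = (\<integral>\<^sup>+ y. ennreal (indicat_real (cball x 1) y *
      (norm (y - x) * \<bar>ks k x y - ks k x (2 *\<^sub>R x - y)\<bar>)) \<partial>lborel)"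

definition far_mass :: "('a::euclidean_space \<Rightarrow> 'a \<Rightarrow> real) \<Rightarrow> 'a \<Rightarrow> ennreal" where
  "far_mass k x = (\<integral>\<^sup>+ y. ennreal (indicat_real {y. 1 \<le> norm (y - x)} y * ks k x y) \<partial>lborel)"

text \<open>The integrands of \<open>eta0 k u v\<close> are \<open>grad u * grad v / 2\<close> and \<open>grad u * twist v\<close>. Where \<open>ks\<close> vanishes
  \<open>twist\<close> divides by \<open>0\<close>; there \<open>ka\<close> vanishes too because \<open>\<bar>ka\<bar> \<le> ks\<close>.\<close>
definition grad :: "('a::euclidean_space \<Rightarrow> 'a \<Rightarrow> real) \<Rightarrow> ('a \<Rightarrow> real) \<Rightarrow> 'a \<times> 'a \<Rightarrow> real" where
  "grad k u p = (u (fst p) - u (snd p)) * sqrt (ks k (fst p) (snd p))"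

definition twist :: "('a::euclidean_space \<Rightarrow> 'a \<Rightarrow> real) \<Rightarrow> ('a \<Rightarrow> real) \<Rightarrow> 'a \<times> 'a \<Rightarrow> real" where
  "twist k v p = v (snd p) * (ka k (fst p) (snd p) / sqrt (ks k (fst p) (snd p)))"

lemma ks_commute: "ks k x y = ks k y x"
  by (simp add: ks_def)

lemma ka_commute: "ka k x y = - ka k y x"
  by (simp add: ka_def field_simps)

text \<open>Here \<open>k\<close> is measurable and nonnegative on the whole product, diagonal
  included, so that no integral has to carry a restriction to \<open>y \<noteq> x\<close>. In
  \<open>sector\<close> the quotient is 0 wherever \<open>ks\<close> vanishes, since division by 0
  gives 0.\<close>

locale jump_kernel =
  fixes k :: "'a::euclidean_space \<Rightarrow> 'a \<Rightarrow> real" and C4 :: real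
  assumes kernel_measurable: "(\<lambda>p. k (fst p) (snd p)) \<in> borel_measurable (borel \<Otimes>\<^sub>M borel)"
    and kernel_nonneg: "0 \<le> k x y"
    and near: "compact K \<Longrightarrow> (\<integral>\<^sup>+ x\<in>K. (near_mass k x)\<^sup>2 \<partial>lborel) < \<infinity>"
    and asym: "compact K \<Longrightarrow> (\<integral>\<^sup>+ x\<in>K. (asymmetry k x)\<^sup>2 \<partial>lborel) < \<infinity>"
    and far: "(\<integral>\<^sup>+ x. (far_mass k x)\<^sup>2 \<partial>lborel) < \<infinity>
      \<or> (\<exists>C::real. AE x in lborel. far_mass k x \<le> ennreal C)"
    and sector: "(\<integral>\<^sup>+ y. ennreal ((ka k x y)\<^sup>2 / ks k x y) \<partial>lborel) \<le> ennreal C4"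
    and C4_nonneg: "0 \<le> C4"
begin

lemma k_measurable [measurable (raw)]:
  assumes [measurable]: "f \<in> M \<rightarrow>\<^sub>M borel" "g \<in> M \<rightarrow>\<^sub>M borel"
  shows "(\<lambda>w. k (f w) (g w)) \<in> borel_measurable M"
  using measurable_compose[OF _ kernel_measurable, of "\<lambda>w. (f w, g w)" M] by simp

lemma ks_measurable [measurable (raw)]:
  assumes [measurable]: "f \<in> M \<rightarrow>\<^sub>M borel" "g \<in> M \<rightarrow>\<^sub>M borel"
  shows "(\<lambda>w. ks k (f w) (g w)) \<in> borel_measurable M"
  unfolding ks_def by measurable

lemma ka_measurable [measurable (raw)]:
  assumes [measurable]: "f \<in> M \<rightarrow>\<^sub>M borel" "g \<in> M \<rightarrow>\<^sub>M borel"
  shows "(\<lambda>w. ka k (f w) (g w)) \<in> borel_measurable M"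
  unfolding ka_def by measurable

lemma ks_nonneg [simp]: "0 \<le> ks k x y"
  using kernel_nonneg by (simp add: ks_def)

lemma abs_ka_le_ks: "\<bar>ka k x y\<bar> \<le> ks k x y"
  using kernel_nonneg[of x y] kernel_nonneg[of y x] by (simp add: ks_def ka_def)

lemma near_mass_measurable [measurable]: "near_mass k \<in> borel_measurable borel"
  unfolding near_mass_def by measurable

lemma asymmetry_measurable [measurable]: "asymmetry k \<in> borel_measurable borel"
  unfolding asymmetry_def cball_def indicator_def by measurable

lemma far_mass_measurable [measurable]: "far_mass k \<in> borel_measurable borel"
  unfolding far_mass_def indicator_def by measurable

section \<open>The form written with \<open>grad\<close> and \<open>twist\<close>\<close>

lemma grad_measurable [measurable]:
  assumes [measurable]: "u \<in> borel_measurable borel"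
  shows "grad k u \<in> borel_measurable lborel2"
  unfolding grad_def by measurable

lemma twist_measurable [measurable]:
  assumes [measurable]: "v \<in> borel_measurable borel"
  shows "twist k v \<in> borel_measurable lborel2"
  unfolding twist_def by measurable

lemma grad_mult_grad:
  "grad k u p * grad k v p = (u (fst p) - u (snd p)) * (v (fst p) - v (snd p)) * ks k (fst p) (snd p)"
proof -
  have "(a * sqrt r) * (b * sqrt r) = a * b * r" if "0 \<le> r" for a b r
    using that by (simp add: ac_simps)
  then show ?thesis by (simp add: grad_def)
qed

lemma grad_mult_twist:
  "grad k u p * twist k v p = (u (fst p) - u (snd p)) * v (snd p) * ka k (fst p) (snd p)"
  using abs_ka_le_ks[of "fst p" "snd p"]
  by (cases "ks k (fst p) (snd p) = 0") (auto simp: grad_def twist_def)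

lemma Energy_eq: "Energy k u = (\<integral>\<^sup>+p. ennreal ((grad k u p)\<^sup>2) \<partial>lborel2)"
  unfolding Energy_def power2_eq_square grad_mult_grad
  by (intro nn_integral_cong) (auto simp: indicator_def)

lemma Eform_eq: "Eform k u v = (\<integral>p. grad k u p * grad k v p \<partial>lborel2)"
  unfolding Eform_def set_lebesgue_integral_def grad_mult_grad
  by (intro Bochner_Integration.integral_cong) (auto simp: indicator_def)

lemma eta0_eq:
  "eta0 k u v = (\<integral>p. grad k u p * grad k v p \<partial>lborel2) / 2 + (\<integral>p. grad k u p * twist k v p \<partial>lborel2)"
  unfolding eta0_def Eform_eq set_lebesgue_integral_def grad_mult_twist
  by (intro arg_cong2[where f = "(+)"] Bochner_Integration.integral_cong) (auto simp: indicator_def)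

lemma Fr_iff:
  "u \<in> Fr k \<longleftrightarrow> u \<in> borel_measurable borel \<and> integrable lborel (\<lambda>x. (u x)\<^sup>2)
    \<and> integrable lborel2 (\<lambda>p. (grad k u p)\<^sup>2)"
proof (cases "u \<in> borel_measurable borel")
  case [measurable]: True
  have "integrable lborel2 (\<lambda>p. (grad k u p)\<^sup>2) \<longleftrightarrow> Energy k u < \<infinity>"
    by (simp add: integrable_iff_bounded Energy_eq)
  then show ?thesis by (simp add: Fr_def L2_def)
qed (simp add: Fr_def L2_def)

lemma FrD:
  assumes "u \<in> Fr k"
  shows "u \<in> borel_measurable borel" "integrable lborel (\<lambda>x. (u x)\<^sup>2)"
    "integrable lborel2 (\<lambda>p. (grad k u p)\<^sup>2)"
  using assms by (simp_all add: Fr_iff)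

section \<open>Continuity of the form in the energy norm\<close>

lemma grad_diff: "grad k (\<lambda>x. u x - v x) p = grad k u p - grad k v p"
  by (simp add: grad_def algebra_simps)

lemma twist_diff: "twist k (\<lambda>x. u x - v x) p = twist k u p - twist k v p"
  unfolding twist_def by (rule left_diff_distrib)

lemma Fr_diff:
  assumes u: "u \<in> Fr k" and v: "v \<in> Fr k"
  shows "(\<lambda>x. u x - v x) \<in> Fr k"
proof -
  note [measurable] = FrD(1)[OF u] FrD(1)[OF v]
  have "integrable lborel (\<lambda>x. (u x - v x)\<^sup>2)" "integrable lborel2 (\<lambda>p. (grad k u p - grad k v p)\<^sup>2)"
    unfolding power2_diff mult.assoc
    using FrD[OF u] FrD[OF v] Cauchy_Schwarz_integral(1)[of u lborel v]
      Cauchy_Schwarz_integral(1)[of "grad k u" lborel2 "grad k v"]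
    by auto
  then show ?thesis by (simp add: Fr_iff grad_diff)
qed

text \<open>The function \<open>v\<close> depends only on the second variable, so the first is
  integrated out at fixed \<open>y\<close>. Since \<open>(ka k x y)\<^sup>2\<close> and
  \<open>ks k x y\<close> are symmetric, what remains inside is the sector integral at
  \<open>y\<close>.\<close>

lemma
  assumes v: "v \<in> Fr k"
  shows integrable_twist: "integrable lborel2 (\<lambda>p. (twist k v p)\<^sup>2)"
    and integral_twist_le: "(\<integral>p. (twist k v p)\<^sup>2 \<partial>lborel2) \<le> C4 * (\<integral>x. (v x)\<^sup>2 \<partial>lborel)"
proof -
  note [measurable] = FrD(1)[OF v]
  have *: "(twist k v (x, y))\<^sup>2 = (v y)\<^sup>2 * ((ka k y x)\<^sup>2 / ks k y x)" for x y
    using ka_commute[of k x y] ks_commute[of k x y]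
    by (simp add: twist_def power_mult_distrib power_divide)
  have "(\<integral>\<^sup>+p. ennreal ((twist k v p)\<^sup>2) \<partial>lborel2)
      = (\<integral>\<^sup>+y. \<integral>\<^sup>+x. ennreal ((twist k v (x, y))\<^sup>2) \<partial>lborel \<partial>lborel)"
    by (subst lborel_pair.nn_integral_snd) auto
  also have "\<dots> = (\<integral>\<^sup>+y. \<integral>\<^sup>+x. ennreal ((v y)\<^sup>2) * ennreal ((ka k y x)\<^sup>2 / ks k y x) \<partial>lborel \<partial>lborel)"
    by (simp add: * flip: ennreal_mult')
  also have "\<dots> = (\<integral>\<^sup>+y. ennreal ((v y)\<^sup>2) * (\<integral>\<^sup>+x. ennreal ((ka k y x)\<^sup>2 / ks k y x) \<partial>lborel) \<partial>lborel)"
    by (intro nn_integral_cong nn_integral_cmult) measurable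
  also have "\<dots> \<le> (\<integral>\<^sup>+y. ennreal ((v y)\<^sup>2) * ennreal C4 \<partial>lborel)"
    by (intro nn_integral_mono mult_left_mono sector) auto
  also have "\<dots> = ennreal (C4 * (\<integral>x. (v x)\<^sup>2 \<partial>lborel))"
    using FrD(2)[OF v] C4_nonneg
    by (subst nn_integral_multc) (auto simp: nn_integral_eq_integral ennreal_mult mult.commute)
  finally have *: "(\<integral>\<^sup>+p. ennreal ((twist k v p)\<^sup>2) \<partial>lborel2) \<le> ennreal (C4 * (\<integral>x. (v x)\<^sup>2 \<partial>lborel))" .
  show i: "integrable lborel2 (\<lambda>p. (twist k v p)\<^sup>2)"
    by (rule integrableI_bounded) (use * in \<open>auto intro: le_less_trans\<close>)
  show "(\<integral>p. (twist k v p)\<^sup>2 \<partial>lborel2) \<le> C4 * (\<integral>x. (v x)\<^sup>2 \<partial>lborel)"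
    using * C4_nonneg by (subst (asm) nn_integral_eq_integral[OF i]) (auto simp: ennreal_le_iff)
qed

lemma
  assumes u: "u \<in> Fr k" and v: "v \<in> Fr k"
  shows integrable_grad_grad: "integrable lborel2 (\<lambda>p. grad k u p * grad k v p)"
    and integrable_grad_twist: "integrable lborel2 (\<lambda>p. grad k u p * twist k v p)"
  using FrD[OF u] FrD[OF v] integrable_twist[OF v] by (auto intro!: Cauchy_Schwarz_integral(1))

text \<open>Cauchy--Schwarz for both integrals, with the norm of the twist replaced by that of
  \<open>v\<close>. With one argument fixed, the bound tends to 0 when the other does so in the
  energy norm.\<close>

lemma eta0_bound:
  assumes u: "u \<in> Fr k" and v: "v \<in> Fr k"
  shows "\<bar>eta0 k u v\<bar> \<le> sqrt (\<integral>p. (grad k u p)\<^sup>2 \<partial>lborel2) *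
    (sqrt (\<integral>p. (grad k v p)\<^sup>2 \<partial>lborel2) + sqrt C4 * sqrt (\<integral>x. (v x)\<^sup>2 \<partial>lborel))"
proof -
  note [measurable] = FrD(1)[OF u] FrD(1)[OF v]
  let ?u = "sqrt (\<integral>p. (grad k u p)\<^sup>2 \<partial>lborel2)" and ?v = "sqrt (\<integral>p. (grad k v p)\<^sup>2 \<partial>lborel2)"
  let ?t = "sqrt (\<integral>p. (twist k v p)\<^sup>2 \<partial>lborel2)"
  have 1: "\<bar>\<integral>p. grad k u p * grad k v p \<partial>lborel2\<bar> \<le> ?u * ?v"
    using FrD[OF u] FrD[OF v] by (intro Cauchy_Schwarz_integral) auto
  have 2: "\<bar>\<integral>p. grad k u p * twist k v p \<partial>lborel2\<bar> \<le> ?u * ?t"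
    using FrD[OF u] integrable_twist[OF v] by (intro Cauchy_Schwarz_integral) auto
  have "?t \<le> sqrt C4 * sqrt (\<integral>x. (v x)\<^sup>2 \<partial>lborel)"
    using integral_twist_le[OF v] by (simp flip: real_sqrt_mult)
  then have 3: "?u * ?t \<le> ?u * (sqrt C4 * sqrt (\<integral>x. (v x)\<^sup>2 \<partial>lborel))"
    by (intro mult_left_mono) auto
  show ?thesis using 1 2 3 unfolding eta0_eq distrib_left by linarith
qed

lemma eta0_diff_left:
  assumes "u \<in> Fr k" "u' \<in> Fr k" "v \<in> Fr k"
  shows "eta0 k (\<lambda>x. u' x - u x) v = eta0 k u' v - eta0 k u v"
  unfolding eta0_eq grad_diff left_diff_distrib
  using assms by (simp add: integrable_grad_grad integrable_grad_twist diff_divide_distrib)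

lemma eta0_diff_right:
  assumes "u \<in> Fr k" "v \<in> Fr k" "v' \<in> Fr k"
  shows "eta0 k u (\<lambda>x. v' x - v x) = eta0 k u v' - eta0 k u v"
  unfolding eta0_eq grad_diff twist_diff right_diff_distrib
  using assms by (simp add: integrable_grad_grad integrable_grad_twist diff_divide_distrib)

text \<open>Each term on the right has a difference in at least one slot, so each tends to 0 along
  approximating sequences.\<close>

lemma eta0_diff:
  assumes "u \<in> Fr k" "u' \<in> Fr k" "v \<in> Fr k" "v' \<in> Fr k"
  shows "eta0 k u' v' - eta0 k u v =
    eta0 k (\<lambda>x. u' x - u x) (\<lambda>x. v' x - v x) + eta0 k (\<lambda>x. u' x - u x) v + eta0 k u (\<lambda>x. v' x - v x)"
  using assms by (simp add: eta0_diff_left eta0_diff_right Fr_diff)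

lemma E1sq_eq:
  assumes "u \<in> Fr k"
  shows "E1sq k u = ennreal ((\<integral>p. (grad k u p)\<^sup>2 \<partial>lborel2) + (\<integral>x. (u x)\<^sup>2 \<partial>lborel))"
  using FrD[OF assms] by (simp add: E1sq_def Energy_eq nn_integral_eq_integral)

lemma E1sq_tendsto_0:
  assumes w: "\<And>n. w n \<in> Fr k" and lim: "(\<lambda>n. E1sq k (w n)) \<longlonglongrightarrow> 0"
  shows "(\<lambda>n. sqrt (\<integral>p. (grad k (w n) p)\<^sup>2 \<partial>lborel2)) \<longlonglongrightarrow> 0"
    and "(\<lambda>n. sqrt (\<integral>x. (w n x)\<^sup>2 \<partial>lborel)) \<longlonglongrightarrow> 0"
proof -
  let ?g = "\<lambda>n. \<integral>p. (grad k (w n) p)\<^sup>2 \<partial>lborel2" and ?l = "\<lambda>n. \<integral>x. (w n x)\<^sup>2 \<partial>lborel"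
  have "(\<lambda>n. ennreal (?g n + ?l n)) \<longlonglongrightarrow> ennreal 0"
    using lim by (simp add: E1sq_eq[OF w])
  then have *: "(\<lambda>n. ?g n + ?l n) \<longlonglongrightarrow> 0"
    by (rule tendsto_ennrealD) simp_all
  have g: "?g \<longlonglongrightarrow> 0"
    by (rule Lim_null_comparison[OF always_eventually *]) simp
  have l: "?l \<longlonglongrightarrow> 0"
    by (rule Lim_null_comparison[OF always_eventually *]) simp
  show "(\<lambda>n. sqrt (?g n)) \<longlonglongrightarrow> 0"
    using tendsto_real_sqrt[OF g] by simp
  show "(\<lambda>n. sqrt (?l n)) \<longlonglongrightarrow> 0"
    using tendsto_real_sqrt[OF l] by simp
qed

lemma eta0_tendsto:
  assumes u: "u \<in> Fr k" and v: "v \<in> Fr k" and \<phi>: "\<And>n. \<phi> n \<in> Fr k" and \<psi>: "\<And>n. \<psi> n \<in> Fr k"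
    and lim: "(\<lambda>n. E1sq k (\<lambda>x. \<phi> n x - u x)) \<longlonglongrightarrow> 0" "(\<lambda>n. E1sq k (\<lambda>x. \<psi> n x - v x)) \<longlonglongrightarrow> 0"
  shows "(\<lambda>n. eta0 k (\<phi> n) (\<psi> n)) \<longlonglongrightarrow> eta0 k u v"
proof -
  have d\<phi>: "(\<lambda>x. \<phi> n x - u x) \<in> Fr k" and d\<psi>: "(\<lambda>x. \<psi> n x - v x) \<in> Fr k" for n
    by (intro Fr_diff \<phi> \<psi> u v)+
  note l\<phi> = E1sq_tendsto_0[where w = "\<lambda>n x. \<phi> n x - u x", OF d\<phi> lim(1)]
    and l\<psi> = E1sq_tendsto_0[where w = "\<lambda>n x. \<psi> n x - v x", OF d\<psi> lim(2)]
  have "(\<lambda>n. eta0 k (\<lambda>x. \<phi> n x - u x) (\<lambda>x. \<psi> n x - v x)) \<longlonglongrightarrow> 0"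
    by (rule Lim_null_comparison[OF always_eventually,
        OF allI, OF eta0_bound[OF d\<phi> d\<psi>, folded real_norm_def]])
      (rule tendsto_eq_intros l\<phi> l\<psi> refl | simp)+
  moreover have "(\<lambda>n. eta0 k (\<lambda>x. \<phi> n x - u x) v) \<longlonglongrightarrow> 0"
    by (rule Lim_null_comparison[OF always_eventually,
        OF allI, OF eta0_bound[OF d\<phi> v, folded real_norm_def]])
      (rule tendsto_eq_intros l\<phi> refl | simp)+
  moreover have "(\<lambda>n. eta0 k u (\<lambda>x. \<psi> n x - v x)) \<longlonglongrightarrow> 0"
    by (rule Lim_null_comparison[OF always_eventually,
        OF allI, OF eta0_bound[OF u d\<psi>, folded real_norm_def]])
      (rule tendsto_eq_intros l\<psi> refl | simp)+
  ultimately have "(\<lambda>n. eta0 k (\<phi> n) (\<psi> n) - eta0 k u v) \<longlonglongrightarrow> 0 + 0 + 0"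
    unfolding eta0_diff[OF u \<phi> v \<psi>] by (intro tendsto_add)
  then show ?thesis by (simp add: LIM_zero_iff)
qed

section \<open>Lipschitz functions in the form domain, and the extended form\<close>

lemma near_mass_compact_finite:
  "compact K \<Longrightarrow> (\<integral>\<^sup>+x\<in>K. near_mass k x \<partial>lborel) < \<infinity>"
  by (rule nn_integral_compact_finite[OF near_mass_measurable _ near])

text \<open>Integrating out the second variable leaves \<open>near_mass\<close>, which is locally
  integrable. The resulting weight is the integrable majorant for functions on the product supported
  over a ball in the first variable.\<close>

lemma nn_integral_near_strip:
  "(\<integral>\<^sup>+p. ennreal (indicat_real (cball 0 R) (fst p) *
      (min 1 ((norm (snd p - fst p))\<^sup>2) * ks k (fst p) (snd p))) \<partial>lborel2) < \<infinity>"
proof -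
  have [measurable]: "cball 0 R \<in> sets (borel :: 'a measure)" by simp
  let ?g = "\<lambda>x y. min 1 ((norm (y - x))\<^sup>2) * ks k x y"
  have "(\<integral>\<^sup>+p. ennreal (indicat_real (cball 0 R) (fst p) * ?g (fst p) (snd p)) \<partial>lborel2)
      = (\<integral>\<^sup>+x. \<integral>\<^sup>+y. ennreal (indicat_real (cball 0 R) x * ?g x y) \<partial>lborel \<partial>lborel)"
    by (subst lborel.nn_integral_fst[symmetric]) auto
  also have "\<dots> = (\<integral>\<^sup>+x\<in>cball 0 R. near_mass k x \<partial>lborel)"
    by (intro nn_integral_cong) (simp add: near_mass_def split: split_indicator)
  also have "\<dots> < \<infinity>" by (intro near_mass_compact_finite) simp
  finally show ?thesis .
qed

lemma integrable_near_strip: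
  "integrable lborel2 (\<lambda>p. indicat_real (cball 0 R) (fst p) *
      (min 1 ((norm (snd p - fst p))\<^sup>2) * ks k (fst p) (snd p)))"
proof (rule integrableI_bounded)
  have [measurable]: "cball 0 R \<in> sets (borel :: 'a measure)" by simp
  show "(\<lambda>p. indicat_real (cball 0 R) (fst p) *
      (min 1 ((norm (snd p - fst p))\<^sup>2) * ks k (fst p) (snd p))) \<in> borel_measurable lborel2"
    by measurable
  show "(\<integral>\<^sup>+p. ennreal (norm (indicat_real (cball 0 R) (fst p) *
      (min 1 ((norm (snd p - fst p))\<^sup>2) * ks k (fst p) (snd p)))) \<partial>lborel2) < \<infinity>"
    using nn_integral_near_strip[of R] by (simp add: abs_mult)
qed

text \<open>\<open>grad k u\<close> vanishes when both points lie outside the ball of radius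
  \<open>R\<close>. Any other pair lies in the strip over that ball or in its image under exchange
  of variables, and both strips carry an integrable weight.\<close>

lemma Lipc_subset_Fr: "Lipc \<subseteq> Fr k"
proof
  fix u :: "'a \<Rightarrow> real"
  assume "u \<in> Lipc"
  then obtain C R where C: "0 \<le> C" and cont: "continuous_on UNIV u"
    and zero: "\<And>x. R < norm x \<Longrightarrow> u x = 0" and bd: "\<And>x. \<bar>u x\<bar> \<le> C"
    and lip: "\<And>x y. \<bar>u x - u y\<bar> \<le> C * min 1 (norm (y - x))"
    using LipcE by metis
  have [measurable]: "u \<in> borel_measurable borel"
    using cont by (rule borel_measurable_continuous_onI)
  have "integrable lborel (\<lambda>x. (u x)\<^sup>2)"
  proof (rule integrableI_bounded_set[where A = "cball 0 R" and B = "C\<^sup>2"])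
    show "emeasure lborel (cball (0::'a) R) < \<infinity>" by (intro emeasure_compact_finite) simp
    show "AE x\<in>cball 0 R in lborel. norm ((u x)\<^sup>2) \<le> C\<^sup>2"
      using bd C by (auto simp: power2_le_iff_abs_le)
    show "AE x in lborel. x \<notin> cball 0 R \<longrightarrow> (u x)\<^sup>2 = 0" using zero by auto
  qed auto
  moreover have "integrable lborel2 (\<lambda>p. (grad k u p)\<^sup>2)"
  proof (rule Bochner_Integration.integrable_bound)
    let ?g = "\<lambda>p. indicat_real (cball 0 R) (fst p) *
      (min 1 ((norm (snd p - fst p))\<^sup>2) * ks k (fst p) (snd p))"
    show "integrable lborel2 (\<lambda>p. C\<^sup>2 * (?g p + ?g (snd p, fst p)))"
      by (intro Bochner_Integration.integrable_add integrable_mult_right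
          integrable_lborel2_swap[OF integrable_near_strip] integrable_near_strip)
    have "(grad k u (x, y))\<^sup>2 \<le> C\<^sup>2 * (?g (x, y) + ?g (y, x))" for x y
    proof (cases "R < norm x \<and> R < norm y")
      case True
      then show ?thesis using zero[of x] zero[of y] by (simp add: grad_def)
    next
      case False
      have "(u x - u y)\<^sup>2 \<le> (C * min 1 (norm (y - x)))\<^sup>2"
        using lip[of x y] C by (intro power2_le_iff_abs_le[THEN iffD2]) auto
      then have "(grad k u (x, y))\<^sup>2 \<le> (C * min 1 (norm (y - x)))\<^sup>2 * ks k x y"
        by (simp add: grad_def power_mult_distrib mult_right_mono)
      also have "\<dots> = C\<^sup>2 * (min 1 ((norm (y - x))\<^sup>2) * ks k x y)"
        by (simp add: power_mult_distrib min_1_power2)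
      also have "\<dots> \<le> C\<^sup>2 * (?g (x, y) + ?g (y, x))"
        using False
        by (intro mult_left_mono)
           (auto simp: ks_commute[of k y x] norm_minus_commute[of x y] split: split_indicator)
      finally show ?thesis .
    qed
    then show "AE p in lborel2. norm ((grad k u p)\<^sup>2) \<le> norm (C\<^sup>2 * (?g p + ?g (snd p, fst p)))"
      by (intro AE_I2) (auto intro: order_trans[OF _ abs_ge_self])
  qed measurable
  ultimately show "u \<in> Fr k" by (simp add: Fr_iff)
qed

lemma E1sq_zero: "E1sq k (\<lambda>x. 0) = 0"
  by (simp add: E1sq_def Energy_def)

lemma Lipc_subset_F0: "Lipc \<subseteq> F0 k"
proof
  fix u :: "'a \<Rightarrow> real"
  assume u: "u \<in> Lipc"
  then show "u \<in> F0 k"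
    unfolding F0_def using Lipc_subset_Fr by (auto intro!: exI[of _ "\<lambda>n. u"] simp: E1sq_zero)
qed

lemma F0E:
  assumes "u \<in> F0 k"
  obtains \<phi> where "u \<in> Fr k" "\<And>n. \<phi> n \<in> Lipc" "\<And>n. \<phi> n \<in> Fr k"
    "(\<lambda>n. E1sq k (\<lambda>x. \<phi> n x - u x)) \<longlonglongrightarrow> 0"
  using assms Lipc_subset_Fr unfolding F0_def by blast

text \<open>Continuity of \<open>eta0\<close> on \<open>Fr\<close> makes \<open>eta0 k u v\<close>
  an admissible value of the description. It is the only one because elements of \<open>F0\<close>
  have approximating sequences, along which the limit is unique.\<close>

lemma eta_eq_eta0:
  assumes u: "u \<in> F0 k" and v: "v \<in> F0 k"
  shows "eta k u v = eta0 k u v"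
  unfolding eta_def
proof (rule the_equality)
  have uv: "u \<in> Fr k" "v \<in> Fr k" using u v by (auto simp: F0_def)
  show lim: "\<forall>\<phi> \<psi>. (\<forall>n. \<phi> n \<in> Lipc \<and> \<psi> n \<in> Lipc) \<and>
       (\<lambda>n. E1sq k (\<lambda>x. \<phi> n x - u x)) \<longlonglongrightarrow> 0 \<and>
       (\<lambda>n. E1sq k (\<lambda>x. \<psi> n x - v x)) \<longlonglongrightarrow> 0 \<longrightarrow>
       (\<lambda>n. eta0 k (\<phi> n) (\<psi> n)) \<longlonglongrightarrow> eta0 k u v"
  proof (intro allI impI, elim conjE)
    fix \<phi> \<psi> :: "nat \<Rightarrow> 'a \<Rightarrow> real"
    assume L: "\<forall>n. \<phi> n \<in> Lipc \<and> \<psi> n \<in> Lipc"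
      and "(\<lambda>n. E1sq k (\<lambda>x. \<phi> n x - u x)) \<longlonglongrightarrow> 0" "(\<lambda>n. E1sq k (\<lambda>x. \<psi> n x - v x)) \<longlonglongrightarrow> 0"
    then show "(\<lambda>n. eta0 k (\<phi> n) (\<psi> n)) \<longlonglongrightarrow> eta0 k u v"
      using uv L Lipc_subset_Fr by (intro eta0_tendsto) blast+
  qed
  obtain \<phi> where \<phi>: "\<And>n. \<phi> n \<in> Lipc" "(\<lambda>n. E1sq k (\<lambda>x. \<phi> n x - u x)) \<longlonglongrightarrow> 0"
    using u by (rule F0E) blast
  obtain \<psi> where \<psi>: "\<And>n. \<psi> n \<in> Lipc" "(\<lambda>n. E1sq k (\<lambda>x. \<psi> n x - v x)) \<longlonglongrightarrow> 0"
    using v by (rule F0E) blast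
  fix c
  assume c: "\<forall>\<phi> \<psi>. (\<forall>n. \<phi> n \<in> Lipc \<and> \<psi> n \<in> Lipc) \<and>
       (\<lambda>n. E1sq k (\<lambda>x. \<phi> n x - u x)) \<longlonglongrightarrow> 0 \<and>
       (\<lambda>n. E1sq k (\<lambda>x. \<psi> n x - v x)) \<longlonglongrightarrow> 0 \<longrightarrow>
       (\<lambda>n. eta0 k (\<phi> n) (\<psi> n)) \<longlonglongrightarrow> c"
  show "c = eta0 k u v"
    by (rule LIMSEQ_unique[of "\<lambda>n. eta0 k (\<phi> n) (\<psi> n)"])
       (use c lim \<phi> \<psi> in blast)+
qed

end

section \<open>The generator on twice differentiable functions\<close>

text \<open>Collects what \<open>C2cE\<close> provides, so that the estimates for the generator can
  be made with one fixed \<open>u\<close>, \<open>Du\<close>, \<open>C\<close> and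
  \<open>R\<close>.\<close>

locale jump_kernel_C2 = jump_kernel k C4
  for k :: "'a::euclidean_space \<Rightarrow> 'a \<Rightarrow> real" and C4 +
  fixes u :: "'a \<Rightarrow> real" and Du :: "'a \<Rightarrow> 'a \<Rightarrow>\<^sub>L real" and C R :: real
  assumes u_Lipc: "u \<in> Lipc"
    and u_continuous: "continuous_on UNIV u"
    and Du_continuous: "continuous_on UNIV Du"
    and u_outside: "\<And>x. R < norm x \<Longrightarrow> u x = 0"
    and Du_outside: "\<And>x. R < norm x \<Longrightarrow> Du x = 0"
    and C_nonneg: "0 \<le> C"
    and u_bound: "\<And>x. \<bar>u x\<bar> \<le> C"
    and Du_bound: "\<And>x. norm (Du x) \<le> C"
    and u_increment: "\<And>x y. \<bar>u y - u x\<bar> \<le> C * min 1 (norm (y - x))"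
    and u_taylor: "\<And>x y. \<bar>u y - u x - Du x (y - x)\<bar> \<le> C * (norm (y - x))\<^sup>2"
begin

definition lin :: "'a \<Rightarrow> 'a \<Rightarrow> real" where
  "lin x y = (if norm (y - x) \<le> 1 then Du x (y - x) else 0)"

text \<open>The three integrands of the generator, including the drift, are kept under a single
  integral sign. They are separated only at points where each is known to be integrable.\<close>

definition integrand :: "'a \<Rightarrow> 'a \<Rightarrow> real" where
  "integrand x y = (u y - u x - lin x y) * ks k x y + lin x y * (ks k x y - ks k x (2 *\<^sub>R x - y)) / 2
    + (u y - u x) * ka k x y"

definition gen :: "'a \<Rightarrow> real" where
  "gen x = (\<integral>y. integrand x y \<partial>lborel)"

definition rotation :: "'a \<Rightarrow> ennreal" where
  "rotation x = (\<integral>\<^sup>+y. ennreal (min 1 (norm (y - x)) * \<bar>ka k x y\<bar>) \<partial>lborel)"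

definition majorant :: "'a \<Rightarrow> ennreal" where
  "majorant x = ennreal C * (near_mass k x + asymmetry k x + rotation x)"

lemma u_measurable [measurable]: "u \<in> borel_measurable borel"
  using u_continuous by (rule borel_measurable_continuous_onI)

lemma Du_apply_measurable [measurable (raw)]:
  assumes [measurable]: "f \<in> M \<rightarrow>\<^sub>M borel" "g \<in> M \<rightarrow>\<^sub>M borel"
  shows "(\<lambda>w. blinfun_apply (Du (f w)) (g w)) \<in> borel_measurable M"
proof -
  have "continuous_on UNIV (\<lambda>p. blinfun_apply (Du (fst p)) (snd p))"
    by (intro continuous_intros continuous_on_compose2[OF Du_continuous]) auto
  then have "(\<lambda>p. blinfun_apply (Du (fst p)) (snd p)) \<in> borel_measurable (borel \<Otimes>\<^sub>M borel)"
    unfolding borel_prod by (rule borel_measurable_continuous_onI)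
  then show ?thesis
    using measurable_compose[of "\<lambda>w. (f w, g w)" M "borel \<Otimes>\<^sub>M borel"
        "\<lambda>p. blinfun_apply (Du (fst p)) (snd p)"] by simp
qed

lemma lin_measurable [measurable (raw)]:
  assumes [measurable]: "f \<in> M \<rightarrow>\<^sub>M borel" "g \<in> M \<rightarrow>\<^sub>M borel"
  shows "(\<lambda>w. lin (f w) (g w)) \<in> borel_measurable M"
  unfolding lin_def by measurable

lemma integrand_measurable [measurable (raw)]:
  assumes [measurable]: "f \<in> M \<rightarrow>\<^sub>M borel" "g \<in> M \<rightarrow>\<^sub>M borel"
  shows "(\<lambda>w. integrand (f w) (g w)) \<in> borel_measurable M"
  unfolding integrand_def by measurable

lemma gen_measurable [measurable]: "gen \<in> borel_measurable borel"
  unfolding gen_def by measurable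

lemma rotation_measurable [measurable]: "rotation \<in> borel_measurable borel"
  unfolding rotation_def by measurable

lemma majorant_measurable [measurable]: "majorant \<in> borel_measurable borel"
  unfolding majorant_def by measurable

section \<open>Bounds for the integrand of the generator\<close>

lemma lin_bound: "\<bar>lin x y\<bar> \<le> C * (indicat_real (cball x 1) y * norm (y - x))"
proof -
  have "\<bar>Du x (y - x)\<bar> \<le> norm (Du x) * norm (y - x)"
    using norm_blinfun[of "Du x" "y - x"] by simp
  also have "\<dots> \<le> C * norm (y - x)"
    by (intro mult_right_mono Du_bound) auto
  finally show ?thesis
    by (auto simp: lin_def dist_norm norm_minus_commute split: split_indicator)
qed

text \<open>Within distance 1 this is the quadratic remainder; beyond it the linear term is cut off
  and the bound on increments suffices.\<close>

lemma taylor_bound: "\<bar>u y - u x - lin x y\<bar> \<le> C * min 1 ((norm (y - x))\<^sup>2)"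
proof (cases "norm (y - x) \<le> 1")
  case True
  then show ?thesis using u_taylor[of y x] power_le_one[of "norm (y - x)" 2]
    by (simp add: lin_def min_def)
next
  case False
  then show ?thesis using u_increment[of y x] one_le_power[of "norm (y - x)" 2]
    by (simp add: lin_def min_def)
qed

lemma integrand_bound:
  "\<bar>integrand x y\<bar> \<le> C * (min 1 ((norm (y - x))\<^sup>2) * ks k x y
     + indicat_real (cball x 1) y * (norm (y - x) * \<bar>ks k x y - ks k x (2 *\<^sub>R x - y)\<bar>)
     + min 1 (norm (y - x)) * \<bar>ka k x y\<bar>)"
proof -
  let ?d = "ks k x y - ks k x (2 *\<^sub>R x - y)"
  have 1: "\<bar>(u y - u x - lin x y) * ks k x y\<bar> \<le> C * min 1 ((norm (y - x))\<^sup>2) * ks k x y"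
    unfolding abs_mult by (simp add: mult_right_mono taylor_bound)
  have "\<bar>lin x y * ?d\<bar> \<le> C * (indicat_real (cball x 1) y * norm (y - x)) * \<bar>?d\<bar>"
    unfolding abs_mult by (intro mult_right_mono lin_bound) auto
  then have 2: "\<bar>lin x y * ?d / 2\<bar> \<le> C * (indicat_real (cball x 1) y * norm (y - x)) * \<bar>?d\<bar>"
    by linarith
  have 3: "\<bar>(u y - u x) * ka k x y\<bar> \<le> C * min 1 (norm (y - x)) * \<bar>ka k x y\<bar>"
    unfolding abs_mult by (intro mult_right_mono u_increment) auto
  have "\<bar>integrand x y\<bar> \<le> C * min 1 ((norm (y - x))\<^sup>2) * ks k x y
     + C * (indicat_real (cball x 1) y * norm (y - x)) * \<bar>?d\<bar>
     + C * min 1 (norm (y - x)) * \<bar>ka k x y\<bar>"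
    unfolding integrand_def using 1 2 3 by linarith
  then show ?thesis by (simp add: distrib_left mult.assoc)
qed

lemma nn_integral_integrand_le: "(\<integral>\<^sup>+y. ennreal \<bar>integrand x y\<bar> \<partial>lborel) \<le> majorant x"
proof -
  let ?a = "\<lambda>y. ennreal (min 1 ((norm (y - x))\<^sup>2) * ks k x y)"
    and ?b = "\<lambda>y. ennreal (indicat_real (cball x 1) y * (norm (y - x) * \<bar>ks k x y - ks k x (2 *\<^sub>R x - y)\<bar>))"
    and ?c = "\<lambda>y. ennreal (min 1 (norm (y - x)) * \<bar>ka k x y\<bar>)"
  have [measurable]: "cball x 1 \<in> sets borel" by simp
  have "(\<integral>\<^sup>+y. ennreal \<bar>integrand x y\<bar> \<partial>lborel) \<le> (\<integral>\<^sup>+y. ennreal C * (?a y + ?b y + ?c y) \<partial>lborel)"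
  proof (rule nn_integral_mono)
    fix y
    have "ennreal \<bar>integrand x y\<bar> \<le> ennreal (C * (min 1 ((norm (y - x))\<^sup>2) * ks k x y
     + indicat_real (cball x 1) y * (norm (y - x) * \<bar>ks k x y - ks k x (2 *\<^sub>R x - y)\<bar>)
     + min 1 (norm (y - x)) * \<bar>ka k x y\<bar>))"
      by (intro ennreal_leI integrand_bound)
    also have "\<dots> = ennreal C * (?a y + ?b y + ?c y)"
      using C_nonneg by (simp add: ennreal_mult)
    finally show "ennreal \<bar>integrand x y\<bar> \<le> ennreal C * (?a y + ?b y + ?c y)" .
  qed
  also have "\<dots> = ennreal C * ((\<integral>\<^sup>+y. ?a y \<partial>lborel) + (\<integral>\<^sup>+y. ?b y \<partial>lborel) + (\<integral>\<^sup>+y. ?c y \<partial>lborel))"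
    by (simp add: nn_integral_cmult nn_integral_add)
  also have "\<dots> = majorant x"
    by (simp add: majorant_def near_mass_def asymmetry_def rotation_def)
  finally show ?thesis .
qed

text \<open>Cauchy--Schwarz after writing \<open>\<bar>ka\<bar>\<close> as \<open>sqrt ks\<close>
  times \<open>\<bar>ka\<bar> / sqrt ks\<close>: the first factor gives \<open>near_mass\<close>,
  the second the sector integral.\<close>

lemma rotation_square_le: "(rotation x)\<^sup>2 \<le> near_mass k x * ennreal C4"
proof -
  have *: "min 1 (norm (y - x)) * \<bar>ka k x y\<bar>
    = (min 1 (norm (y - x)) * sqrt (ks k x y)) * (\<bar>ka k x y\<bar> / sqrt (ks k x y))" for y
    using abs_ka_le_ks[of x y] by (cases "ks k x y = 0") auto
  have "(rotation x)\<^sup>2 = (\<integral>\<^sup>+y. ennreal (min 1 (norm (y - x)) * sqrt (ks k x y)) *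
      ennreal (\<bar>ka k x y\<bar> / sqrt (ks k x y)) \<partial>lborel)\<^sup>2"
    unfolding rotation_def * by (subst ennreal_mult) auto
  also have "\<dots> \<le> (\<integral>\<^sup>+y. (ennreal (min 1 (norm (y - x)) * sqrt (ks k x y)))\<^sup>2 \<partial>lborel) *
      (\<integral>\<^sup>+y. (ennreal (\<bar>ka k x y\<bar> / sqrt (ks k x y)))\<^sup>2 \<partial>lborel)"
    by (rule Cauchy_Schwarz_nn_integral) auto
  also have "\<dots> = near_mass k x * (\<integral>\<^sup>+y. ennreal ((ka k x y)\<^sup>2 / ks k x y) \<partial>lborel)"
    by (simp add: near_mass_def ennreal_power power_mult_distrib power_divide min_1_power2)
  also have "\<dots> \<le> near_mass k x * ennreal C4"
    by (intro mult_left_mono sector) auto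
  finally show ?thesis .
qed

text \<open>The squares of \<open>near_mass\<close> and \<open>asymmetry\<close> are locally
  integrable by assumption. The square of \<open>rotation\<close> is bounded by a multiple of
  \<open>near_mass\<close> itself, which is locally integrable too.\<close>

lemma majorant_square_finite:
  assumes K: "compact K"
  shows "(\<integral>\<^sup>+x\<in>K. (majorant x)\<^sup>2 \<partial>lborel) < \<infinity>"
proof -
  have [measurable]: "K \<in> sets borel" using K by (simp add: borel_compact)
  let ?w = "near_mass k" and ?d = "asymmetry k"
  have "(majorant x)\<^sup>2 \<le> ennreal (C\<^sup>2) * (2 * (2 * ((?w x)\<^sup>2 + (?d x)\<^sup>2) + ?w x * ennreal C4))" for x
  proof -
    have "(?w x + ?d x + rotation x)\<^sup>2 \<le> 2 * ((?w x + ?d x)\<^sup>2 + (rotation x)\<^sup>2)"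
      by (rule ennreal_square_add_le)
    also have "\<dots> \<le> 2 * (2 * ((?w x)\<^sup>2 + (?d x)\<^sup>2) + ?w x * ennreal C4)"
      by (intro mult_left_mono add_mono ennreal_square_add_le rotation_square_le) auto
    finally have "(ennreal C)\<^sup>2 * (?w x + ?d x + rotation x)\<^sup>2
      \<le> (ennreal C)\<^sup>2 * (2 * (2 * ((?w x)\<^sup>2 + (?d x)\<^sup>2) + ?w x * ennreal C4))"
      by (intro mult_left_mono) auto
    then show ?thesis
      using C_nonneg by (simp add: majorant_def power_mult_distrib ennreal_power)
  qed
  then have "(\<integral>\<^sup>+x\<in>K. (majorant x)\<^sup>2 \<partial>lborel) \<le> (\<integral>\<^sup>+x. ennreal (C\<^sup>2) *
      (2 * (2 * ((?w x)\<^sup>2 * indicator K x + (?d x)\<^sup>2 * indicator K x)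
        + ?w x * indicator K x * ennreal C4)) \<partial>lborel)"
    by (intro nn_integral_mono) (auto split: split_indicator)
  also have "\<dots> = ennreal (C\<^sup>2) * (2 * (2 * ((\<integral>\<^sup>+x\<in>K. (?w x)\<^sup>2 \<partial>lborel) + (\<integral>\<^sup>+x\<in>K. (?d x)\<^sup>2 \<partial>lborel))
      + (\<integral>\<^sup>+x\<in>K. ?w x \<partial>lborel) * ennreal C4))"
    by (simp add: nn_integral_cmult nn_integral_multc nn_integral_add)
  also have "\<dots> < \<infinity>"
    using near[OF K] asym[OF K] near_mass_compact_finite[OF K]
    by (simp add: ennreal_mult_less_top)
  finally show ?thesis .
qed

lemma majorant_compact_finite:
  "compact K \<Longrightarrow> (\<integral>\<^sup>+x\<in>K. majorant x \<partial>lborel) < \<infinity>"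
  by (rule nn_integral_compact_finite[OF majorant_measurable _ majorant_square_finite])

section \<open>Square integrability of the generator\<close>

lemma abs_gen_le: "ennreal \<bar>gen x\<bar> \<le> (\<integral>\<^sup>+y. ennreal \<bar>integrand x y\<bar> \<partial>lborel)"
  using norm_integral_le_nn_integral[of lborel "integrand x"] by (simp add: gen_def)

text \<open>Only long jumps into the ball carrying \<open>u\<close> count here. Restricting the
  landing point makes this integrable over the whole space, even when \<open>far_mass\<close> is
  merely bounded.\<close>

definition tail :: "'a \<Rightarrow> ennreal" where
  "tail x = (\<integral>\<^sup>+y. ennreal (indicat_real (cball 0 R) y * (indicat_real {y. 1 \<le> norm (y - x)} y * ks k x y)) \<partial>lborel)"

lemma tail_measurable [measurable]: "tail \<in> borel_measurable borel"
proof -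
  have [measurable]: "cball 0 R \<in> sets (borel :: 'a measure)" by simp
  show ?thesis unfolding tail_def indicator_def[of "{y. 1 \<le> norm (y - x)}" for x] by measurable
qed

lemma tail_le_far_mass: "tail x \<le> far_mass k x"
  unfolding tail_def far_mass_def
  by (intro nn_integral_mono ennreal_leI) (auto split: split_indicator)

lemma far_mass_le_near_mass: "far_mass k x \<le> near_mass k x"
  unfolding near_mass_def far_mass_def
proof (intro nn_integral_mono ennreal_leI)
  fix y
  have "1 \<le> (norm (y - x))\<^sup>2" if "1 \<le> norm (y - x)"
    using that by (rule one_le_power)
  then show "indicat_real {y. 1 \<le> norm (y - x)} y * ks k x y \<le> min 1 ((norm (y - x))\<^sup>2) * ks k x y"
    by (auto split: split_indicator simp: min_def)
qed

text \<open>By Tonelli and the symmetry of \<open>ks\<close>, long jumps into the ball from anywhere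
  have the same total mass as long jumps out of the ball, which \<open>near_mass\<close> controls on
  compact sets.\<close>

lemma tail_integral_finite: "(\<integral>\<^sup>+x. tail x \<partial>lborel) < \<infinity>"
proof -
  have [measurable]: "cball 0 R \<in> sets (borel :: 'a measure)" by simp
  let ?g = "\<lambda>x y. indicat_real (cball 0 R) y * (indicat_real {y. 1 \<le> norm (y - x)} y * ks k x y)"
  have [measurable]: "(\<lambda>p. ennreal (?g (fst p) (snd p))) \<in> borel_measurable (lborel2 :: ('a \<times> 'a) measure)"
    unfolding indicator_def[of "{y. 1 \<le> norm (y - x)}" for x] by measurable
  have "(\<integral>\<^sup>+x. tail x \<partial>lborel) = (\<integral>\<^sup>+y. \<integral>\<^sup>+x. ennreal (?g x y) \<partial>lborel \<partial>lborel)"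
    unfolding tail_def
    using lborel_pair.Fubini'[of "\<lambda>x y. ennreal (?g x y)"] by (simp add: case_prod_unfold)
  also have "\<dots> = (\<integral>\<^sup>+y\<in>cball 0 R. far_mass k y \<partial>lborel)"
    by (intro nn_integral_cong)
       (auto simp: far_mass_def ks_commute[of k _ y for y] norm_minus_commute indicator_def
         intro!: nn_integral_cong)
  also have "\<dots> \<le> (\<integral>\<^sup>+y\<in>cball 0 R. near_mass k y \<partial>lborel)"
    by (intro nn_integral_mono mult_right_mono far_mass_le_near_mass) auto
  also have "\<dots> < \<infinity>" by (rule near_mass_compact_finite) simp
  finally show ?thesis .
qed

lemma tail_square_finite: "(\<integral>\<^sup>+x. (tail x)\<^sup>2 \<partial>lborel) < \<infinity>"
  using far
proof
  assume "(\<integral>\<^sup>+x. (far_mass k x)\<^sup>2 \<partial>lborel) < \<infinity>"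
  moreover have "(\<integral>\<^sup>+x. (tail x)\<^sup>2 \<partial>lborel) \<le> (\<integral>\<^sup>+x. (far_mass k x)\<^sup>2 \<partial>lborel)"
    by (intro nn_integral_mono power_mono tail_le_far_mass) auto
  ultimately show ?thesis by (rule le_less_trans[rotated])
next
  assume "\<exists>C::real. AE x in lborel. far_mass k x \<le> ennreal C"
  then obtain B where B: "AE x in lborel. far_mass k x \<le> ennreal B" by blast
  \<comment> \<open>A function that is both bounded and integrable is square integrable: one factor
    of the square is replaced by the bound.\<close>
  have "(\<integral>\<^sup>+x. (tail x)\<^sup>2 \<partial>lborel) \<le> (\<integral>\<^sup>+x. ennreal B * tail x \<partial>lborel)"
    using B
    by (intro nn_integral_mono_AE)
       (auto simp: power2_eq_square intro!: mult_right_mono intro: order_trans[OF tail_le_far_mass])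
  also have "\<dots> = ennreal B * (\<integral>\<^sup>+x. tail x \<partial>lborel)"
    by (rule nn_integral_cmult) measurable
  also have "\<dots> < \<infinity>" using tail_integral_finite by (simp add: ennreal_mult_less_top)
  finally show ?thesis .
qed

text \<open>At such \<open>x\<close> both \<open>u\<close> and \<open>Du\<close> vanish, leaving
  \<open>u y * (ks k x y + ka k x y)\<close>. This is nonzero only for \<open>y\<close> in the ball
  of radius \<open>R\<close>, at distance at least 1 from \<open>x\<close>, and the factor 2 comes
  from \<open>\<bar>ka\<bar> \<le> ks\<close>.\<close>

lemma abs_gen_outside:
  assumes x: "R + 1 < norm x"
  shows "ennreal \<bar>gen x\<bar> \<le> ennreal (2 * C) * tail x"
proof -
  have [measurable]: "cball 0 R \<in> sets (borel :: 'a measure)" by simp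
  let ?g = "\<lambda>y. indicat_real (cball 0 R) y * (indicat_real {y. 1 \<le> norm (y - x)} y * ks k x y)"
  have u0: "u x = 0" and lin0: "lin x y = 0" for y
    using x by (auto simp: u_outside Du_outside lin_def)
  have "\<bar>integrand x y\<bar> \<le> 2 * C * ?g y" for y
  proof (cases "norm y \<le> R")
    case True
    have "1 \<le> norm (y - x)"
      using True x norm_triangle_ineq2[of x y] by (simp add: norm_minus_commute)
    then have g: "?g y = ks k x y" using True by simp
    have "\<bar>ks k x y + ka k x y\<bar> \<le> 2 * ks k x y"
      using abs_ka_le_ks[of x y] ks_nonneg[of x y] by linarith
    then have "\<bar>u y\<bar> * \<bar>ks k x y + ka k x y\<bar> \<le> C * (2 * ks k x y)"
      by (intro mult_mono u_bound C_nonneg) auto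
    moreover have "integrand x y = u y * (ks k x y + ka k x y)"
      by (simp add: integrand_def u0 lin0 distrib_left)
    ultimately show ?thesis unfolding g by (simp add: abs_mult)
  next
    case False
    then show ?thesis by (simp add: integrand_def u0 lin0 u_outside)
  qed
  then have "(\<integral>\<^sup>+y. ennreal \<bar>integrand x y\<bar> \<partial>lborel) \<le> (\<integral>\<^sup>+y. ennreal (2 * C) * ennreal (?g y) \<partial>lborel)"
    using C_nonneg by (intro nn_integral_mono) (simp flip: ennreal_mult)
  also have "\<dots> = ennreal (2 * C) * tail x"
    unfolding tail_def by (intro nn_integral_cmult) (simp add: indicator_def[of "{y. 1 \<le> norm (y - x)}"])
  finally show ?thesis using abs_gen_le[of x] by (rule order_trans[rotated])
qed

text \<open>The local majorant is used on the ball of radius \<open>R + 1\<close> and the tail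
  estimate outside it.\<close>

lemma gen_L2: "gen \<in> L2"
proof -
  let ?B = "cball (0::'a) (R + 1)"
  have [measurable]: "?B \<in> sets borel" by simp
  have "(\<integral>\<^sup>+x. ennreal ((gen x)\<^sup>2) \<partial>lborel)
      \<le> (\<integral>\<^sup>+x. (majorant x)\<^sup>2 * indicator ?B x + ennreal ((2 * C)\<^sup>2) * (tail x)\<^sup>2 \<partial>lborel)"
  proof (rule nn_integral_mono)
    fix x
    have sq: "ennreal ((gen x)\<^sup>2) = (ennreal \<bar>gen x\<bar>)\<^sup>2" by (simp add: ennreal_power)
    show "ennreal ((gen x)\<^sup>2) \<le> (majorant x)\<^sup>2 * indicator ?B x + ennreal ((2 * C)\<^sup>2) * (tail x)\<^sup>2"
    proof (cases "R + 1 < norm x")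
      case True
      then have "(ennreal \<bar>gen x\<bar>)\<^sup>2 \<le> (ennreal (2 * C) * tail x)\<^sup>2"
        by (intro power_mono abs_gen_outside) auto
      also have "\<dots> = ennreal ((2 * C)\<^sup>2) * (tail x)\<^sup>2"
        using C_nonneg by (simp add: power_mult_distrib ennreal_power del: ennreal_mult'')
      finally show ?thesis unfolding sq by (rule order_trans) simp
    next
      case False
      have "(ennreal \<bar>gen x\<bar>)\<^sup>2 \<le> (majorant x)\<^sup>2"
        by (intro power_mono order_trans[OF abs_gen_le nn_integral_integrand_le]) auto
      with False show ?thesis unfolding sq by (simp add: add_increasing2)
    qed
  qed
  also have "\<dots> = (\<integral>\<^sup>+x\<in>?B. (majorant x)\<^sup>2 \<partial>lborel) + ennreal ((2 * C)\<^sup>2) * (\<integral>\<^sup>+x. (tail x)\<^sup>2 \<partial>lborel)"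
    by (simp add: nn_integral_cmult nn_integral_add)
  also have "\<dots> < \<infinity>"
    using majorant_square_finite[of ?B] tail_square_finite by (simp add: ennreal_mult_less_top)
  finally show ?thesis by (auto simp: L2_def integrable_iff_bounded)
qed

section \<open>The weak identity for Lipschitz test functions\<close>

lemma integrable_near_bounded:
  assumes [measurable]: "h \<in> borel_measurable lborel2"
    and bound: "\<And>x y. \<bar>h (x, y)\<bar> \<le> A * (indicat_real (cball 0 R') x * (min 1 ((norm (y - x))\<^sup>2) * ks k x y))"
  shows "integrable lborel2 h"
proof (rule Bochner_Integration.integrable_bound)
  show "integrable lborel2 (\<lambda>p. A * (indicat_real (cball 0 R') (fst p) *
      (min 1 ((norm (snd p - fst p))\<^sup>2) * ks k (fst p) (snd p))))"
    by (intro integrable_mult_right integrable_near_strip)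
  show "AE p in lborel2. norm (h p) \<le> norm (A * (indicat_real (cball 0 R') (fst p) *
      (min 1 ((norm (snd p - fst p))\<^sup>2) * ks k (fst p) (snd p))))"
    using bound by (intro AE_I2) (auto intro: order_trans[OF _ abs_ge_self])
qed fact

lemma lin_reflect: "lin x (2 *\<^sub>R x - y) = - lin x y"
proof -
  have *: "2 *\<^sub>R x - y - x = - (y - x)" by (simp add: scaleR_2)
  show ?thesis unfolding lin_def * norm_minus_cancel blinfun.minus_right by simp
qed

text \<open>The three integrable pieces below are permuted, up to sign, by \<open>(x, y) \<mapsto> (y, x)\<close> and by
  \<open>(x, y) \<mapsto> (x, 2x - y)\<close>; without the cut-off \<open>e\<close> two of them need not be integrable.\<close>
lemma truncated_identity:
  assumes v: "v \<in> Lipc" and e: "0 < e" "e \<le> 1"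
  shows "(\<integral>p. indicat_real {p. e < norm (snd p - fst p)} p *
     (grad k u p * grad k v p / 2 + grad k u p * twist k v p + v (fst p) * integrand (fst p) (snd p)) \<partial>lborel2) = 0"
proof -
  obtain C' R' where C': "0 \<le> C'" and cont: "continuous_on UNIV v"
    and v0: "\<And>x. R' < norm x \<Longrightarrow> v x = 0" and vbd: "\<And>x. \<bar>v x\<bar> \<le> C'"
    using v by (rule LipcE) blast
  have [measurable]: "v \<in> borel_measurable borel"
    using cont by (rule borel_measurable_continuous_onI)
  define I where "I p = indicat_real {p. e < norm (snd p - fst p)} p" for p :: "'a \<times> 'a"
  have [measurable]: "I \<in> borel_measurable lborel2"
    unfolding I_def indicator_def by measurable
  have I_swap: "I (y, x) = I (x, y)" for x y
    by (simp add: I_def indicator_def norm_minus_commute)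
  have I_reflect: "I (x, 2 *\<^sub>R x - y) = I (x, y)" for x y
  proof -
    have *: "2 *\<^sub>R x - y - x = - (y - x)" by (simp add: scaleR_2)
    show ?thesis unfolding I_def indicator_def mem_Collect_eq fst_conv snd_conv * norm_minus_cancel ..
  qed
  \<comment> \<open>\<open>a\<close> carries the symmetric jump part, \<open>b\<close> the
    antisymmetric one and \<open>c\<close> the linear compensator.\<close>
  define a where "a p = I p * ((u (fst p) - u (snd p)) * v (fst p) * ks k (fst p) (snd p))" for p
  define b where "b p = I p * (grad k u p * twist k v p)" for p
  define c where "c p = I p * (v (fst p) * lin (fst p) (snd p) * ks k (fst p) (snd p))" for p

  \<comment> \<open>Where \<open>e < norm (y - x)\<close>, the weight
    \<open>m = min 1 (norm (y - x))\<close> is at least \<open>e\<close>, so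
    \<open>m \<le> m\<^sup>2 / e\<close>. The cut-off thus trades a first-order bound for the
    integrable second-order weight at the cost of \<open>1 / e\<close>.\<close>
  have cut: "I (x, y) * \<bar>t * v x * ks k x y\<bar>
      \<le> C * C' / e * (indicat_real (cball 0 R') x * (min 1 ((norm (y - x))\<^sup>2) * ks k x y))"
    if t: "\<bar>t\<bar> \<le> C * min 1 (norm (y - x))" for x y t
  proof (cases "e < norm (y - x) \<and> norm x \<le> R'")
    case True
    let ?m = "min 1 (norm (y - x))"
    have "e \<le> ?m" using True e by simp
    then have "?m * e \<le> ?m * ?m" by (intro mult_left_mono) auto
    then have "?m \<le> (min 1 ((norm (y - x))\<^sup>2)) / e"
      using e min_1_power2[of "norm (y - x)"] by (simp add: pos_le_divide_eq power2_eq_square)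
    then have "C * ?m \<le> C * (min 1 ((norm (y - x))\<^sup>2) / e)"
      using C_nonneg by (rule mult_left_mono)
    then have "\<bar>t\<bar> * \<bar>v x\<bar> * ks k x y \<le> C * (min 1 ((norm (y - x))\<^sup>2) / e) * C' * ks k x y"
      using t vbd[of x] C' by (intro mult_right_mono mult_mono) auto
    then show ?thesis using True by (simp add: I_def abs_mult ac_simps)
  next
    case False
    then show ?thesis using v0[of x] C_nonneg C' e
      by (auto simp: I_def split: split_indicator)
  qed
  have ia: "integrable lborel2 a"
  proof (rule integrable_near_bounded)
    show "a \<in> borel_measurable lborel2" unfolding a_def by measurable
    show "\<bar>a (x, y)\<bar> \<le> C * C' / e * (indicat_real (cball 0 R') x * (min 1 ((norm (y - x))\<^sup>2) * ks k x y))" for x y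
      using cut[of "u x - u y" y x] u_increment[of y x]
      by (simp add: a_def abs_mult I_def abs_minus_commute)
  qed
  have ic: "integrable lborel2 c"
  proof (rule integrable_near_bounded)
    show "c \<in> borel_measurable lborel2" unfolding c_def by measurable
    fix x y
    have "\<bar>lin x y\<bar> \<le> C * min 1 (norm (y - x))"
      using lin_bound[of x y] C_nonneg
      by (auto simp: dist_norm norm_minus_commute lin_def split: split_indicator_asm)
    then show "\<bar>c (x, y)\<bar> \<le> C * C' / e * (indicat_real (cball 0 R') x * (min 1 ((norm (y - x))\<^sup>2) * ks k x y))"
      using cut[of "lin x y" y x] by (simp add: c_def abs_mult I_def ac_simps)
  qed
  have ib: "integrable lborel2 b"
  proof (rule Bochner_Integration.integrable_bound)
    show "integrable lborel2 (\<lambda>p. grad k u p * twist k v p)"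
      using u_Lipc v Lipc_subset_Fr by (intro integrable_grad_twist) auto
    show "b \<in> borel_measurable lborel2" unfolding b_def by measurable
    show "AE p in lborel2. norm (b p) \<le> norm (grad k u p * twist k v p)"
      by (intro AE_I2) (auto simp: b_def I_def split: split_indicator)
  qed
  note sa = integrable_lborel2_swap[OF ia] and sb = integrable_lborel2_swap[OF ib]
    and rc = integrable_lborel2_reflect[OF ic]
  \<comment> \<open>The drift correction replaces \<open>ks k x y\<close> in front of
    \<open>lin x y\<close> by the mean of its values at \<open>y\<close> and \<open>2x - y\<close>.
    As \<open>lin x\<close> is odd under this reflection, the linear terms form a difference of
    \<open>c\<close> and its reflection; the other two brackets are differences under exchange of
    variables.\<close>
  have eq: "I p * (grad k u p * grad k v p / 2 + grad k u p * twist k v p + v (fst p) * integrand (fst p) (snd p))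
    = (a (snd p, fst p) - a p) / 2 + (b p - b (snd p, fst p)) + (c (fst p, 2 *\<^sub>R fst p - snd p) - c p) / 2"
    for p
  proof (cases p)
    case (Pair x y)
    show ?thesis
      unfolding Pair a_def b_def c_def integrand_def grad_mult_grad grad_mult_twist
      using ks_commute[of k y x] ka_commute[of k y x]
      by (simp add: I_swap I_reflect lin_reflect field_simps)
  qed
  show ?thesis
    unfolding I_def[symmetric] eq
    using ia ib ic sa sb rc
    by (simp add: integral_lborel2_swap integral_lborel2_reflect)
qed

text \<open>The support of \<open>v\<close> confines \<open>x\<close> to a ball, on which
  \<open>majorant\<close> is integrable; Fubini then applies.\<close>

lemma
  assumes v: "v \<in> Lipc"
  shows integrable_mult_integrand: "integrable lborel2 (\<lambda>p. v (fst p) * integrand (fst p) (snd p))"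
    and integral_mult_integrand: "(\<integral>p. v (fst p) * integrand (fst p) (snd p) \<partial>lborel2) = (\<integral>x. gen x * v x \<partial>lborel)"
proof -
  obtain C' R' where C': "0 \<le> C'" and cont: "continuous_on UNIV v"
    and v0: "\<And>x. R' < norm x \<Longrightarrow> v x = 0" and vbd: "\<And>x. \<bar>v x\<bar> \<le> C'"
    using v by (rule LipcE) blast
  have [measurable]: "v \<in> borel_measurable borel"
    using cont by (rule borel_measurable_continuous_onI)
  have [measurable]: "cball 0 R' \<in> sets (borel :: 'a measure)" by simp
  have "(\<integral>\<^sup>+p. ennreal (norm (v (fst p) * integrand (fst p) (snd p))) \<partial>lborel2)
      = (\<integral>\<^sup>+x. \<integral>\<^sup>+y. ennreal \<bar>v x\<bar> * ennreal \<bar>integrand x y\<bar> \<partial>lborel \<partial>lborel)"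
    by (subst lborel.nn_integral_fst[symmetric]) (auto simp: abs_mult ennreal_mult)
  also have "\<dots> \<le> (\<integral>\<^sup>+x. ennreal C' * (majorant x * indicator (cball 0 R') x) \<partial>lborel)"
  proof (rule nn_integral_mono)
    fix x
    have "(\<integral>\<^sup>+y. ennreal \<bar>v x\<bar> * ennreal \<bar>integrand x y\<bar> \<partial>lborel) = ennreal \<bar>v x\<bar> * (\<integral>\<^sup>+y. ennreal \<bar>integrand x y\<bar> \<partial>lborel)"
      by (rule nn_integral_cmult) measurable
    also have "\<dots> \<le> ennreal C' * (majorant x * indicator (cball 0 R') x)"
    proof (cases "norm x \<le> R'")
      case True
      then show ?thesis using vbd[of x] nn_integral_integrand_le[of x]
        by (auto intro!: mult_mono ennreal_leI)
    next
      case False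
      then show ?thesis using v0[of x] by simp
    qed
    finally show "(\<integral>\<^sup>+y. ennreal \<bar>v x\<bar> * ennreal \<bar>integrand x y\<bar> \<partial>lborel)
      \<le> ennreal C' * (majorant x * indicator (cball 0 R') x)" .
  qed
  also have "\<dots> = ennreal C' * (\<integral>\<^sup>+x\<in>cball 0 R'. majorant x \<partial>lborel)"
    by (rule nn_integral_cmult) measurable
  also have "\<dots> < \<infinity>"
    using majorant_compact_finite[of "cball 0 R'"] by (simp add: ennreal_mult_less_top)
  finally show i: "integrable lborel2 (\<lambda>p. v (fst p) * integrand (fst p) (snd p))"
    by (intro integrableI_bounded) measurable
  show "(\<integral>p. v (fst p) * integrand (fst p) (snd p) \<partial>lborel2) = (\<integral>x. gen x * v x \<partial>lborel)"
    using lborel_pair.integral_fst'[OF i] by (simp add: gen_def mult.commute)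
qed

text \<open>The complete integrand is absolutely integrable although its pieces \<open>a\<close> and
  \<open>c\<close> in \<open>truncated_identity\<close> need not be without a cut-off, so dominated
  convergence removes it.\<close>

lemma eta0_Lipc:
  assumes v: "v \<in> Lipc"
  shows "eta0 k u v = - (\<integral>x. gen x * v x \<partial>lborel)"
proof -
  let ?H = "\<lambda>p. grad k u p * grad k v p / 2 + grad k u p * twist k v p + v (fst p) * integrand (fst p) (snd p)"
  \<comment> \<open>The cut-off \<open>1 / real (Suc n)\<close> lies in the range from 0 to 1 that
    \<open>truncated_identity\<close> demands.\<close>
  let ?I = "\<lambda>n p. indicat_real {p. 1 / real (Suc n) < norm (snd p - fst p)} p"
  have uv: "u \<in> Fr k" "v \<in> Fr k" using u_Lipc v Lipc_subset_Fr by auto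
  note int = integrable_grad_grad[OF uv] integrable_grad_twist[OF uv] integrable_mult_integrand[OF v]
  have iH: "integrable lborel2 ?H"
    using int by simp
  have [measurable]: "?I n \<in> borel_measurable (lborel2 :: ('a \<times> 'a) measure)" for n
    unfolding indicator_def by measurable
  have [measurable]: "?H \<in> borel_measurable lborel2"
    using iH by simp
  have "(\<lambda>n. \<integral>p. ?I n p * ?H p \<partial>lborel2) \<longlonglongrightarrow> (\<integral>p. ?H p \<partial>lborel2)"
  proof (rule integral_dominated_convergence[where w = "\<lambda>p. norm (?H p)"])
    show "AE p in lborel2. (\<lambda>n. ?I n p * ?H p) \<longlonglongrightarrow> ?H p"
    proof (rule AE_I2)
      fix p :: "'a \<times> 'a"
      show "(\<lambda>n. ?I n p * ?H p) \<longlonglongrightarrow> ?H p"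
      \<comment> \<open>The cut-offs never reach the diagonal, but the integrand is 0 there.\<close>
      proof (cases "fst p = snd p")
        case True
        then have "?H p = 0" by (simp add: grad_def integrand_def lin_def)
        then show ?thesis by simp
      next
        case False
        then obtain N where N: "1 / real (Suc N) < norm (snd p - fst p)"
          using nat_approx_posE[of "norm (snd p - fst p)"] by auto
        have "\<forall>\<^sub>F n in sequentially. ?I n p * ?H p = ?H p"
          unfolding eventually_sequentially
        proof (intro exI allI impI)
          fix n assume "N \<le> n"
          then have "1 / real (Suc n) \<le> 1 / real (Suc N)" by (simp add: frac_le)
          with N show "?I n p * ?H p = ?H p" by simp
        qed
        then show ?thesis by (rule tendsto_eventually)
      qed
    qed
    show "AE p in lborel2. norm (?I n p * ?H p) \<le> norm (?H p)" for n
      by (intro AE_I2) (auto split: split_indicator)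
  qed (use iH in \<open>auto intro: integrable_norm\<close>)
  moreover have "(\<integral>p. ?I n p * ?H p \<partial>lborel2) = 0" for n
    by (rule truncated_identity[OF v]) auto
  ultimately have "(\<integral>p. ?H p \<partial>lborel2) = 0"
    by (simp add: LIMSEQ_const_iff)
  moreover have "(\<integral>p. ?H p \<partial>lborel2) = eta0 k u v + (\<integral>x. gen x * v x \<partial>lborel)"
    using int by (simp add: eta0_eq integral_mult_integrand[OF v])
  ultimately show ?thesis by simp
qed

section \<open>Passage to the whole form domain\<close>

lemma u_F0: "u \<in> F0 k"
  using u_Lipc Lipc_subset_F0 by auto

lemma integrable_gen_square: "integrable lborel (\<lambda>x. (gen x)\<^sup>2)"
  using gen_L2 by (simp add: L2_def)

lemma
  assumes "w \<in> Fr k"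
  shows integrable_gen_mult: "integrable lborel (\<lambda>x. gen x * w x)"
    and abs_integral_gen_mult_le:
      "\<bar>\<integral>x. gen x * w x \<partial>lborel\<bar> \<le> L2norm gen * sqrt (\<integral>x. (w x)\<^sup>2 \<partial>lborel)"
  using FrD[OF assms] integrable_gen_square Cauchy_Schwarz_integral[of gen lborel w]
  by (auto simp: L2norm_def)

lemma integral_gen_diff:
  assumes "v \<in> Fr k" "w \<in> Fr k"
  shows "(\<integral>x. gen x * w x \<partial>lborel) - (\<integral>x. gen x * v x \<partial>lborel) = (\<integral>x. gen x * (w x - v x) \<partial>lborel)"
  using assms by (simp add: right_diff_distrib integrable_gen_mult)

text \<open>Both sides pass to the limit along Lipschitz approximations of \<open>v\<close>: the
  left by \<open>eta0_tendsto\<close> with a constant first sequence, the right by Cauchy--Schwarz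
  against \<open>gen\<close> in \<open>L2\<close>.\<close>

lemma eta_eq:
  assumes v: "v \<in> F0 k"
  shows "eta k u v = - (\<integral>x. gen x * v x \<partial>lborel)"
proof -
  have u: "u \<in> Fr k" using u_Lipc Lipc_subset_Fr by auto
  obtain \<phi> where v': "v \<in> Fr k" and \<phi>: "\<And>n. \<phi> n \<in> Lipc" "\<And>n. \<phi> n \<in> Fr k"
    and lim: "(\<lambda>n. E1sq k (\<lambda>x. \<phi> n x - v x)) \<longlonglongrightarrow> 0"
    using v by (rule F0E) blast
  have "(\<lambda>n. eta0 k u (\<phi> n)) \<longlonglongrightarrow> eta0 k u v"
    using u v' \<phi>(2) lim by (intro eta0_tendsto) (auto simp: E1sq_zero)
  moreover have "(\<lambda>n. eta0 k u (\<phi> n)) \<longlonglongrightarrow> - (\<integral>x. gen x * v x \<partial>lborel)"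
  proof -
    have d: "(\<lambda>x. \<phi> n x - v x) \<in> Fr k" for n by (intro Fr_diff \<phi>(2) v')
    have "(\<lambda>n. L2norm gen * sqrt (\<integral>x. (\<phi> n x - v x)\<^sup>2 \<partial>lborel)) \<longlonglongrightarrow> L2norm gen * 0"
      by (intro tendsto_mult_left E1sq_tendsto_0(2)[where w = "\<lambda>n x. \<phi> n x - v x", OF d lim])
    then have "(\<lambda>n. L2norm gen * sqrt (\<integral>x. (\<phi> n x - v x)\<^sup>2 \<partial>lborel)) \<longlonglongrightarrow> 0" by simp
    then have "(\<lambda>n. \<integral>x. gen x * (\<phi> n x - v x) \<partial>lborel) \<longlonglongrightarrow> 0"
      by (rule Lim_null_comparison[rotated]) (use abs_integral_gen_mult_le[OF d] in simp)
    then have "(\<lambda>n. (\<integral>x. gen x * \<phi> n x \<partial>lborel) - (\<integral>x. gen x * v x \<partial>lborel)) \<longlonglongrightarrow> 0"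
      by (simp add: integral_gen_diff v' \<phi>(2))
    then have "(\<lambda>n. \<integral>x. gen x * \<phi> n x \<partial>lborel) \<longlonglongrightarrow> (\<integral>x. gen x * v x \<partial>lborel)"
      by (simp add: LIM_zero_iff)
    then show ?thesis unfolding eta0_Lipc[OF \<phi>(1)] by (rule tendsto_minus)
  qed
  ultimately have "eta0 k u v = - (\<integral>x. gen x * v x \<partial>lborel)"
    by (rule LIMSEQ_unique)
  then show ?thesis using eta_eq_eta0[OF u_F0 v] by simp
qed

lemma u_genD: "u \<in> genD k"
  unfolding genD_def
proof (intro CollectI conjI ballI allI impI u_F0)
  fix v and \<epsilon> :: real
  assume v: "v \<in> F0 k" and \<epsilon>: "0 < \<epsilon>"
  have N: "0 \<le> L2norm gen" by (simp add: L2norm_def)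
  show "\<exists>\<delta>>0. \<forall>w\<in>F0 k. L2norm (\<lambda>x. w x - v x) < \<delta> \<longrightarrow> \<bar>eta k u w - eta k u v\<bar> < \<epsilon>"
  proof (intro exI conjI ballI impI)
    \<comment> \<open>\<open>L2norm gen\<close> is a Lipschitz constant for \<open>eta k u\<close>;
      adding 1 keeps the denominator positive when it is 0.\<close>
    show "0 < \<epsilon> / (L2norm gen + 1)" using N \<epsilon> by simp
    fix w assume w: "w \<in> F0 k" and less: "L2norm (\<lambda>x. w x - v x) < \<epsilon> / (L2norm gen + 1)"
    have vw: "v \<in> Fr k" "w \<in> Fr k" using v w by (auto simp: F0_def)
    have "\<bar>eta k u w - eta k u v\<bar> = \<bar>\<integral>x. gen x * (w x - v x) \<partial>lborel\<bar>"
      unfolding eta_eq[OF v] eta_eq[OF w] integral_gen_diff[OF vw, symmetric] by simp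
    also have "\<dots> \<le> L2norm gen * L2norm (\<lambda>x. w x - v x)"
      using abs_integral_gen_mult_le[OF Fr_diff[OF vw(2,1)]] by (simp add: L2norm_def)
    also have "\<dots> \<le> (L2norm gen + 1) * L2norm (\<lambda>x. w x - v x)"
      by (intro mult_right_mono) (auto simp: L2norm_def)
    also have "\<dots> < \<epsilon>"
      using less N by (simp add: pos_less_divide_eq mult.commute)
    finally show "\<bar>eta k u w - eta k u v\<bar> < \<epsilon>" .
  qed
qed

text \<open>The generator is determined only up to null sets, so the explicit formula may differ
  from \<open>gen\<close> where its separate integrals fail to converge.\<close>

lemma is_gen_AE:
  assumes [measurable]: "f \<in> borel_measurable borel" and AE: "AE x in lborel. f x = gen x"
  shows "is_gen k u f"
  unfolding is_gen_def
proof (intro conjI ballI u_genD)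
  have "integrable lborel (\<lambda>x. (f x)\<^sup>2) \<longleftrightarrow> integrable lborel (\<lambda>x. (gen x)\<^sup>2)"
    using AE by (intro integrable_cong_AE) auto
  then show "f \<in> L2" using integrable_gen_square by (simp add: L2_def)
  fix v assume v: "v \<in> F0 k"
  then have [measurable]: "v \<in> borel_measurable borel" using FrD(1) by (auto simp: F0_def)
  have "(\<integral>x. f x * v x \<partial>lborel) = (\<integral>x. gen x * v x \<partial>lborel)"
    using AE by (intro integral_cong_AE) auto
  then show "eta k u v = - (\<integral>x. f x * v x \<partial>lborel)" using eta_eq[OF v] by simp
qed

section \<open>The explicit formula\<close>

definition drift :: "'a \<Rightarrow> 'a" where
  "drift x = (\<integral>y. indicat_real (cball x 1) y *\<^sub>R ((ks k x y - ks k x (2 *\<^sub>R x - y)) *\<^sub>R (y - x)) \<partial>lborel)"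

text \<open>Finiteness of \<open>near_mass\<close> at \<open>x\<close> forces that of
  \<open>rotation\<close> by \<open>rotation_square_le\<close>. Then each of the three parts is
  integrable on its own and the integral may be split.\<close>

lemma gen_split:
  assumes near: "near_mass k x < \<infinity>" and asym: "asymmetry k x < \<infinity>"
  shows "gen x = (\<integral>y. (u y - u x - lin x y) * ks k x y \<partial>lborel) + Du x (drift x) / 2
    + (\<integral>y. (u y - u x) * ka k x y \<partial>lborel)"
proof -
  have [measurable]: "cball x 1 \<in> sets borel" by simp
  let ?d = "\<lambda>y. ks k x y - ks k x (2 *\<^sub>R x - y)"
  let ?V = "\<lambda>y. indicat_real (cball x 1) y *\<^sub>R (?d y *\<^sub>R (y - x))"
  have "near_mass k x * ennreal C4 < \<infinity>"
    using near by (simp add: ennreal_mult_less_top)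
  then have "(rotation x)\<^sup>2 < \<infinity>" by (rule le_less_trans[OF rotation_square_le])
  then have rot: "rotation x < \<infinity>" by (simp add: power_less_top_ennreal)
  have i1: "integrable lborel (\<lambda>y. (u y - u x - lin x y) * ks k x y)"
  proof (rule Bochner_Integration.integrable_bound)
    show "integrable lborel (\<lambda>y. C * (min 1 ((norm (y - x))\<^sup>2) * ks k x y))"
      using near by (intro integrable_mult_right integrableI_bounded) (auto simp: near_mass_def abs_mult)
    show "AE y in lborel. norm ((u y - u x - lin x y) * ks k x y) \<le> norm (C * (min 1 ((norm (y - x))\<^sup>2) * ks k x y))"
      using taylor_bound[of _ x] C_nonneg
      by (intro AE_I2) (auto simp: abs_mult mult_right_mono simp flip: mult.assoc)
  qed measurable
  have i2: "integrable lborel ?V"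
  proof (rule integrableI_bounded)
    have "norm (?V y) = indicat_real (cball x 1) y * (norm (y - x) * \<bar>?d y\<bar>)" for y
      by (auto split: split_indicator)
    then show "(\<integral>\<^sup>+y. ennreal (norm (?V y)) \<partial>lborel) < \<infinity>"
      using asym by (simp only: asymmetry_def)
  qed measurable
  have i3: "integrable lborel (\<lambda>y. (u y - u x) * ka k x y)"
  proof (rule Bochner_Integration.integrable_bound)
    show "integrable lborel (\<lambda>y. C * (min 1 (norm (y - x)) * \<bar>ka k x y\<bar>))"
      using rot by (intro integrable_mult_right integrableI_bounded) (auto simp: rotation_def abs_mult)
    show "AE y in lborel. norm ((u y - u x) * ka k x y) \<le> norm (C * (min 1 (norm (y - x)) * \<bar>ka k x y\<bar>))"
      using u_increment[of _ x] C_nonneg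
      by (intro AE_I2) (auto simp: abs_mult mult_right_mono simp flip: mult.assoc)
  qed measurable
  \<comment> \<open>The bounded linear map \<open>Du x\<close> commutes with the vector-valued
    integral \<open>drift x\<close>.\<close>
  have "Du x (?V y) = lin x y * ?d y" for y
    by (auto simp: lin_def dist_norm norm_minus_commute blinfun.scaleR_right split: split_indicator)
  then have i2': "integrable lborel (\<lambda>y. lin x y * ?d y)"
    and e2: "(\<integral>y. lin x y * ?d y \<partial>lborel) = Du x (drift x)"
    using integrable_bounded_linear[OF blinfun.bounded_linear_right i2, of "Du x"]
      integral_bounded_linear[OF blinfun.bounded_linear_right i2, of "Du x"]
    by (simp_all add: drift_def)
  show ?thesis
    unfolding gen_def integrand_def using i1 i2' i3 by (simp add: e2)
qed

text \<open>Translation by \<open>x\<close>; the excluded increment \<open>z = 0\<close> contributes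
  nothing because the integrand vanishes there.\<close>

lemma drift_eq:
  "drift x = (LINT z:{z. 0 < norm z \<and> norm z \<le> 1}|lborel. (ks k x (x + z) - ks k x (x - z)) *\<^sub>R z)"
proof -
  have [measurable]: "cball x 1 \<in> sets borel" by simp
  let ?g = "\<lambda>y. indicat_real (cball x 1) y *\<^sub>R ((ks k x y - ks k x (2 *\<^sub>R x - y)) *\<^sub>R (y - x))"
  have *: "2 *\<^sub>R x - (x + z) = x - z" for z by (simp add: scaleR_2)
  have "drift x = (\<integral>z. ?g (x + z) \<partial>lborel)"
    unfolding drift_def by (rule integral_lborel_translate[symmetric]) measurable
  also have "\<dots> = (LINT z:{z. 0 < norm z \<and> norm z \<le> 1}|lborel. (ks k x (x + z) - ks k x (x - z)) *\<^sub>R z)"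
    unfolding set_lebesgue_integral_def *
    by (intro Bochner_Integration.integral_cong) (auto simp: dist_norm split: split_indicator)
  finally show ?thesis .
qed

lemma near_integral_eq:
  "(\<integral>y. (u y - u x - lin x y) * ks k x y \<partial>lborel)
    = (LINT z:{z. z \<noteq> 0}|lborel. (u (x + z) - u x - (if norm z \<le> 1 then Du x z else 0)) * ks k x (x + z))"
proof -
  let ?g = "\<lambda>y. (u y - u x - lin x y) * ks k x y"
  have "(\<integral>y. ?g y \<partial>lborel) = (\<integral>z. ?g (x + z) \<partial>lborel)"
    by (rule integral_lborel_translate[symmetric]) measurable
  also have "\<dots> = (LINT z:{z. z \<noteq> 0}|lborel. (u (x + z) - u x - (if norm z \<le> 1 then Du x z else 0)) * ks k x (x + z))"
    unfolding set_lebesgue_integral_def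
    by (intro Bochner_Integration.integral_cong) (auto simp: lin_def split: split_indicator)
  finally show ?thesis .
qed

text \<open>\<open>near_mass\<close> and \<open>asymmetry\<close> are locally integrable, hence
  finite almost everywhere, and at such points \<open>gen_split\<close> identifies the formula with
  \<open>gen\<close>.\<close>

lemma is_gen_explicit:
  "is_gen k u (\<lambda>x. (LINT z:{z. z \<noteq> 0}|lborel.
        (u (x + z) - u x - (if norm z \<le> 1 then Du x z else 0)) * ks k x (x + z))
      + (1/2) * Du x (LINT z:{z. 0 < norm z \<and> norm z \<le> 1}|lborel. (ks k x (x + z) - ks k x (x - z)) *\<^sub>R z)
      + (LINT y:{y. y \<noteq> x}|lborel. (u y - u x) * ka k x y))"
proof -
  have 3: "(LINT y:{y. y \<noteq> x}|lborel. (u y - u x) * ka k x y) = (\<integral>y. (u y - u x) * ka k x y \<partial>lborel)" for x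
    unfolding set_lebesgue_integral_def
    by (intro Bochner_Integration.integral_cong) (auto split: split_indicator)
  have [measurable]: "drift \<in> borel_measurable borel"
    unfolding drift_def indicator_def mem_cball by measurable
  show ?thesis
    unfolding near_integral_eq[symmetric] drift_eq[symmetric] 3
  proof (rule is_gen_AE)
    show "(\<lambda>x. (\<integral>y. (u y - u x - lin x y) * ks k x y \<partial>lborel) + 1 / 2 * Du x (drift x)
      + (\<integral>y. (u y - u x) * ka k x y \<partial>lborel)) \<in> borel_measurable borel"
      by measurable
    have "AE x in lborel. near_mass k x < \<infinity>"
      by (rule AE_finite_of_compact[OF near_mass_measurable near_mass_compact_finite])
    moreover have "AE x in lborel. asymmetry k x < \<infinity>"
      by (rule AE_finite_of_compact[OF asymmetry_measurable
            nn_integral_compact_finite[OF asymmetry_measurable _ asym]])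
    ultimately show "AE x in lborel. (\<integral>y. (u y - u x - lin x y) * ks k x y \<partial>lborel) + 1 / 2 * Du x (drift x)
      + (\<integral>y. (u y - u x) * ka k x y \<partial>lborel) = gen x"
      by eventually_elim (simp add: gen_split)
  qed
qed

end

section \<open>Removing the diagonal\<close>

text \<open>Every double integral in these definitions carries the indicator of the off-diagonal
  pairs, so the integrands agree pointwise.\<close>

lemma
  assumes "\<And>x y. x \<noteq> y \<Longrightarrow> k' x y = k x y"
  shows genD_cong: "genD k' = genD k" and is_gen_cong: "is_gen k' = is_gen k"
proof -
  have ks: "ks k' x y = ks k x y" and ka: "ka k' x y = ka k x y" if "x \<noteq> y" for x y
    using assms[of x y] assms[of y x] that by (auto simp: ks_def ka_def)
  have "Energy k' = Energy k"
    unfolding Energy_def by (intro ext nn_integral_cong) (auto simp: ks split: split_indicator)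
  moreover have "eta0 k' = eta0 k"
    unfolding eta0_def Eform_def set_lebesgue_integral_def
    by (intro ext arg_cong2[where f = "(+)"] arg_cong2[where f = "(/)"] Bochner_Integration.integral_cong)
       (auto simp: ks ka split: split_indicator)
  ultimately have *: "E1sq k' = E1sq k" "F0 k' = F0 k" "eta k' = eta k"
    by (auto simp: fun_eq_iff E1sq_def F0_def Fr_def eta_def)
  show "genD k' = genD k" unfolding genD_def * ..
  then show "is_gen k' = is_gen k" by (simp add: fun_eq_iff is_gen_def *)
qed

theorem theorem1p3:
  fixes k :: "'a::euclidean_space \<Rightarrow> 'a \<Rightarrow> real"
  assumes meas: "(\<lambda>p. k (fst p) (snd p)) \<in>
      borel_measurable (restrict_space (lborel \<Otimes>\<^sub>M lborel) {(x,y). x \<noteq> y})"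
    and nonneg: "\<forall>x y. x \<noteq> y \<longrightarrow> 0 \<le> k x y"
    and A1: "\<forall>K. compact K \<longrightarrow>
      (\<integral>\<^sup>+ x\<in>K. (\<integral>\<^sup>+ y\<in>{y. y \<noteq> x}. ennreal (min 1 ((norm (y - x))^2) * ks k x y) \<partial>lborel)^2 \<partial>lborel) < \<infinity>"
    and A2: "\<forall>K. compact K \<longrightarrow>
      (\<integral>\<^sup>+ x\<in>K. (\<integral>\<^sup>+ z\<in>{z. 0 < norm z \<and> norm z \<le> 1}.
          ennreal (norm z * \<bar>ks k x (x + z) - ks k x (x - z)\<bar>) \<partial>lborel)^2 \<partial>lborel) < \<infinity>"
    and A3: "(\<integral>\<^sup>+ x. (\<integral>\<^sup>+ y\<in>{y. norm (y - x) \<ge> 1}. ennreal (ks k x y) \<partial>lborel)^2 \<partial>lborel) < \<infinity>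
      \<or> (\<exists>C::real. AE x in lborel. (\<integral>\<^sup>+ y\<in>{y. norm (y - x) \<ge> 1}. ennreal (ks k x y) \<partial>lborel) \<le> ennreal C)"
    and A4: "(SUP x. \<integral>\<^sup>+ y\<in>{y. y \<noteq> x \<and> ks k x y \<noteq> 0}. ennreal ((ka k x y)^2 / ks k x y) \<partial>lborel) < \<infinity>"
    and A5: "\<forall>x. (\<integral>\<^sup>+ y\<in>{y. 0 < norm (x - y) \<and> norm (x - y) \<le> 1}.
                  ennreal (norm (x - y) * \<bar>ka k x y\<bar>) \<partial>lborel) < \<infinity>"
  shows "C2c \<subseteq> genD k \<and>
    (\<forall>u\<in>C2c. is_gen k u (\<lambda>x.
        (LINT z:{z. z \<noteq> 0}|lborel.
           (u (x + z) - u x - (if norm z \<le> 1 then frechet_derivative u (at x) z else 0)) * ks k x (x + z))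
      + (1/2) * frechet_derivative u (at x)
           (LINT z:{z. 0 < norm z \<and> norm z \<le> 1}|lborel. (ks k x (x + z) - ks k x (x - z)) *\<^sub>R z)
      + (LINT y:{y. y \<noteq> x}|lborel. (u y - u x) * ka k x y)))"
proof -
  \<comment> \<open>The hypotheses leave \<open>k\<close> arbitrary on the diagonal. Setting it to 0
    there gives a kernel that is measurable and nonnegative on the whole product.\<close>
  define k' where "k' x y = (if x = y then 0 else k x y)" for x y
  have k': "k' x y = k x y" if "x \<noteq> y" for x y using that by (simp add: k'_def)
  have ks': "ks k' x y = ks k x y" and ka': "ka k' x y = ka k x y" if "x \<noteq> y" for x y
    using that by (simp_all add: ks_def ka_def k'_def)
  have ka0: "ka k' x x = 0" for x by (simp add: ka_def)
  have ks'_nonneg: "0 \<le> ks k' x y" for x y using nonneg by (simp add: ks_def k'_def)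
  let ?S = "SUP x. \<integral>\<^sup>+ y\<in>{y. y \<noteq> x \<and> ks k x y \<noteq> 0}. ennreal ((ka k x y)^2 / ks k x y) \<partial>lborel"
  have meas': "(\<lambda>p. k' (fst p) (snd p)) \<in> borel_measurable (borel \<Otimes>\<^sub>M borel)"
  proof -
    \<comment> \<open>The off-diagonal set is open, and the product of the two Lebesgue measures has
      the Borel sets of the product space.\<close>
    have D: "{(x, y). x \<noteq> y} \<in> sets (lborel2 :: ('a \<times> 'a) measure)"
    proof -
      have "sets (lborel2 :: ('a \<times> 'a) measure) = sets borel"
        by (subst borel_prod[symmetric]) (intro sets_pair_measure_cong sets_lborel)
      moreover have "{p. fst p \<noteq> snd p} \<in> sets (borel :: ('a \<times> 'a) measure)"
        by (intro borel_open open_Collect_neq continuous_intros)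
      moreover have "{p. fst p \<noteq> snd p} = {(x, y :: 'a). x \<noteq> y}" by auto
      ultimately show ?thesis by metis
    qed
    have "(\<lambda>p. indicat_real {(x, y). x \<noteq> y} p *\<^sub>R k (fst p) (snd p)) \<in> borel_measurable lborel2"
      using meas D by (subst (asm) borel_measurable_restrict_space_iff) auto
    moreover have "(\<lambda>p. indicat_real {(x, y). x \<noteq> y} p *\<^sub>R k (fst p) (snd p)) = (\<lambda>p. k' (fst p) (snd p))"
      by (auto simp: k'_def fun_eq_iff split: split_indicator)
    ultimately show ?thesis by simp
  qed
  have ks'_measurable [measurable (raw)]: "(\<lambda>w. ks k' (f w) (g w)) \<in> borel_measurable M"
    if [measurable]: "f \<in> M \<rightarrow>\<^sub>M borel" "g \<in> M \<rightarrow>\<^sub>M borel" for f g and M :: "'a measure"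
    unfolding ks_def
    using measurable_compose[OF _ meas', of "\<lambda>w. (f w, g w)" M]
      measurable_compose[OF _ meas', of "\<lambda>w. (g w, f w)" M] by simp
  have near_eq: "near_mass k' x = (\<integral>\<^sup>+ y\<in>{y. y \<noteq> x}. ennreal (min 1 ((norm (y - x))^2) * ks k x y) \<partial>lborel)" for x
    unfolding near_mass_def by (intro nn_integral_cong) (auto simp: ks' split: split_indicator)
  have asym_eq: "asymmetry k' x = (\<integral>\<^sup>+ z\<in>{z. 0 < norm z \<and> norm z \<le> 1}.
          ennreal (norm z * \<bar>ks k x (x + z) - ks k x (x - z)\<bar>) \<partial>lborel)" for x
  proof -
    have [measurable]: "cball x 1 \<in> sets borel" by simp
    let ?g = "\<lambda>y. ennreal (indicat_real (cball x 1) y *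
      (norm (y - x) * \<bar>ks k' x y - ks k' x (2 *\<^sub>R x - y)\<bar>))"
    have *: "2 *\<^sub>R x - (x + z) = x - z" for z by (simp add: scaleR_2)
    have "asymmetry k' x = (\<integral>\<^sup>+z. ?g (x + z) \<partial>lborel)"
      unfolding asymmetry_def by (rule nn_integral_lborel_translate[symmetric]) measurable
    also have "\<dots> = (\<integral>\<^sup>+ z\<in>{z. 0 < norm z \<and> norm z \<le> 1}.
          ennreal (norm z * \<bar>ks k x (x + z) - ks k x (x - z)\<bar>) \<partial>lborel)"
      unfolding * by (intro nn_integral_cong) (auto simp: dist_norm ks' split: split_indicator)
    finally show ?thesis .
  qed
  have far_eq: "far_mass k' x = (\<integral>\<^sup>+ y\<in>{y. norm (y - x) \<ge> 1}. ennreal (ks k x y) \<partial>lborel)" for x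
    unfolding far_mass_def
  proof (intro nn_integral_cong)
    fix y
    have "x \<noteq> y" if "1 \<le> norm (y - x)" using that by auto
    then show "ennreal (indicat_real {y. 1 \<le> norm (y - x)} y * ks k' x y)
      = ennreal (ks k x y) * indicator {y. 1 \<le> norm (y - x)} y"
      by (auto simp: ks' split: split_indicator)
  qed
  \<comment> \<open>By \<open>A4\<close> the supremum is finite, so it equals its conversion to a
    real constant.\<close>
  have kernel: "jump_kernel k' (enn2real ?S)"
  proof
    show "(\<lambda>p. k' (fst p) (snd p)) \<in> borel_measurable (borel \<Otimes>\<^sub>M borel)" by (rule meas')
    show "0 \<le> k' x y" for x y using nonneg by (simp add: k'_def)
    show "(\<integral>\<^sup>+ x\<in>K. (near_mass k' x)\<^sup>2 \<partial>lborel) < \<infinity>" if "compact K" for K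
      using A1 that unfolding near_eq by blast
    show "(\<integral>\<^sup>+ x\<in>K. (asymmetry k' x)\<^sup>2 \<partial>lborel) < \<infinity>" if "compact K" for K
      using A2 that unfolding asym_eq by blast
    show "(\<integral>\<^sup>+ x. (far_mass k' x)\<^sup>2 \<partial>lborel) < \<infinity> \<or> (\<exists>C::real. AE x in lborel. far_mass k' x \<le> ennreal C)"
      using A3 unfolding far_eq .
    show "0 \<le> enn2real ?S" by simp
    show "(\<integral>\<^sup>+ y. ennreal ((ka k' x y)\<^sup>2 / ks k' x y) \<partial>lborel) \<le> ennreal (enn2real ?S)" for x
    proof -
      \<comment> \<open>Extending the domain to all \<open>y\<close> adds only zeros:
        \<open>ka k'\<close> vanishes on the diagonal, and a quotient with denominator 0 is
        0.\<close>
      have "(\<integral>\<^sup>+ y. ennreal ((ka k' x y)\<^sup>2 / ks k' x y) \<partial>lborel)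
        = (\<integral>\<^sup>+ y\<in>{y. y \<noteq> x \<and> ks k x y \<noteq> 0}. ennreal ((ka k x y)^2 / ks k x y) \<partial>lborel)"
      proof (intro nn_integral_cong)
        fix y
        show "ennreal ((ka k' x y)\<^sup>2 / ks k' x y)
          = ennreal ((ka k x y)^2 / ks k x y) * indicator {y. y \<noteq> x \<and> ks k x y \<noteq> 0} y"
          by (cases "y = x") (auto simp: ka0 ks' ka' split: split_indicator)
      qed
      also have "\<dots> \<le> ?S" by (rule SUP_upper) simp
      also have "\<dots> = ennreal (enn2real ?S)" using A4 by (simp add: less_top)
      finally show ?thesis .
    qed
  qed
  have gen: "is_gen k u (\<lambda>x.
        (LINT z:{z. z \<noteq> 0}|lborel.
           (u (x + z) - u x - (if norm z \<le> 1 then frechet_derivative u (at x) z else 0)) * ks k x (x + z))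
      + (1/2) * frechet_derivative u (at x)
           (LINT z:{z. 0 < norm z \<and> norm z \<le> 1}|lborel. (ks k x (x + z) - ks k x (x - z)) *\<^sub>R z)
      + (LINT y:{y. y \<noteq> x}|lborel. (u y - u x) * ka k x y))" (is "is_gen k u ?f")
    if u: "u \<in> C2c" for u
  proof -
    obtain Du C R where Du: "\<And>x. (u has_derivative blinfun_apply (Du x)) (at x)"
      and C2: "continuous_on UNIV Du"
        "\<And>x. R < norm x \<Longrightarrow> u x = 0" "\<And>x. R < norm x \<Longrightarrow> Du x = 0" "0 \<le> C"
        "\<And>x. \<bar>u x\<bar> \<le> C" "\<And>x. norm (Du x) \<le> C"
        "\<And>x y. \<bar>u y - u x\<bar> \<le> C * min 1 (norm (y - x))"
        "\<And>x y. \<bar>u y - u x - Du x (y - x)\<bar> \<le> C * (norm (y - x))\<^sup>2"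
      using u by (rule C2cE) blast
    have cont: "continuous_on UNIV u"
      using Du by (intro has_derivative_continuous_on) auto
    have Lipc: "u \<in> Lipc" using u C2c_subset_Lipc by blast
    interpret jump_kernel k' "enn2real ?S" by (rule kernel)
    interpret jump_kernel_C2 k' "enn2real ?S" u Du C R
      by unfold_locales (fact Lipc cont C2)+
    have fd: "frechet_derivative u (at x) = blinfun_apply (Du x)" for x
      using frechet_derivative_at[OF Du] by simp
    \<comment> \<open>Each domain of integration keeps the arguments of the kernel apart, so
      \<open>k\<close> and \<open>k'\<close> give the same formula at every
      \<open>x\<close>.\<close>
    have "?f = (\<lambda>x. (LINT z:{z. z \<noteq> 0}|lborel.
        (u (x + z) - u x - (if norm z \<le> 1 then Du x z else 0)) * ks k' x (x + z))
      + (1/2) * Du x (LINT z:{z. 0 < norm z \<and> norm z \<le> 1}|lborel. (ks k' x (x + z) - ks k' x (x - z)) *\<^sub>R z)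
      + (LINT y:{y. y \<noteq> x}|lborel. (u y - u x) * ka k' x y))"
      unfolding fd set_lebesgue_integral_def
      by (intro ext arg_cong2[where f = "(+)"] arg_cong2[where f = "(*)"] refl
          arg_cong[where f = "blinfun_apply _"] Bochner_Integration.integral_cong)
         (auto simp: ks' ka' split: split_indicator)
    then show ?thesis
      using is_gen_explicit is_gen_cong[of k' k, OF k'] by simp
  qed
  then show ?thesis by (auto simp: is_gen_def)
qed

end
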